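(* Let $(X,Y)$ be a pair of real-valued random variables with a joint density, and let $K\ge1$ be such that $I(X;Y)\le\log K$, i.e. $h(X,Y)\geq h(X)+h(Y)-\log K$, and $$h(X+Y)\leq\tfrac12h(X)+\tfrac12h(Y)+\log K.$$ Let $(X_2,Y,X_1,Y')$ be random variables forming a Markov chain $X_2 - Y - X_1 - Y'$ (i.e. $X_1,X_2$ are conditionally independent given $Y$, and $Y'$ is conditionally independent of $(X_2,Y)$ given $X_1$), such that each of the pairs $(X_2,Y)$, $(X_1,Y)$ and $(X_1,Y')$ has the same joint distribution as $(X,Y)$. Then $$h(X_2\mid X_1,Y)\geq h(X)-\log K,$$ $$h(Y'\mid X_1,Y)\geq h(Y)-\log K,$$ $$h(X_2+Y'\mid X_1,Y)\leq\tfrac12h(X)+\tfrac12h(Y)+7\log K.$$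
   Context: Standing conventions: random variables are real-valued with densities (vectors have joint densities), all (conditional) differential entropies $h$ appearing exist and are finite. $I(U;V)=h(U)+h(V)-h(U,V)$; $\log$ is the natural logarithm. *)

theory Defs
  imports "HOL-Probability.Probability"
begin

text \<open>Differential entropy (natural logarithm): the library notion
  prob_space.entropy with base exp 1, taken w.r.t. Lebesgue(-Borel) measure
  (products of lborel for random vectors).  Conditional differential entropy:
  the library notion prob_space.conditional_entropy with base exp 1.\<close>

abbreviation dent :: "'a measure \<Rightarrow> 'b measure \<Rightarrow> ('a \<Rightarrow> 'b) \<Rightarrow> real" where
  "dent M S V \<equiv> prob_space.entropy M (exp 1) S V"

abbreviation cdent :: "'a measure \<Rightarrow> 'b measure \<Rightarrow> 'c measure \<Rightarrow> ('a \<Rightarrow> 'b) \<Rightarrow> ('a \<Rightarrow> 'c) \<Rightarrow> real" where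
  "cdent M S T V W \<equiv> prob_space.conditional_entropy M (exp 1) S T V W"

definition has_density :: "'a measure \<Rightarrow> 'b measure \<Rightarrow> ('a \<Rightarrow> 'b) \<Rightarrow> bool" where
  "has_density M S V \<longleftrightarrow>
     (\<exists>f. distributed M S V (\<lambda>x. ennreal (f x)) \<and> (\<forall>x\<in>space S. 0 \<le> f x))"

definition has_finite_dentropy :: "'a measure \<Rightarrow> 'b measure \<Rightarrow> ('a \<Rightarrow> 'b) \<Rightarrow> bool" where
  "has_finite_dentropy M S V \<longleftrightarrow>
     (\<exists>f. distributed M S V (\<lambda>x. ennreal (f x)) \<and> (\<forall>x\<in>space S. 0 \<le> f x) \<and>
          integrable S (\<lambda>x. f x * ln (f x)))"

definition gen_sigma :: "'a measure \<Rightarrow> ('a \<Rightarrow> 'c) \<Rightarrow> 'c measure \<Rightarrow> 'a measure" where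
  "gen_sigma M W T = vimage_algebra (space M) W T"

definition cond_indep ::
  "'a measure \<Rightarrow> 'b measure \<Rightarrow> ('a \<Rightarrow> 'b) \<Rightarrow> 'c measure \<Rightarrow> ('a \<Rightarrow> 'c) \<Rightarrow>
   'd measure \<Rightarrow> ('a \<Rightarrow> 'd) \<Rightarrow> bool" where
  "cond_indep M S U T V R W \<longleftrightarrow>
     (\<forall>A\<in>sets S. \<forall>B\<in>sets T. AE \<omega> in M.
        real_cond_exp M (gen_sigma M W R) (\<lambda>\<omega>. indicator A (U \<omega>) * indicator B (V \<omega>)) \<omega> =
        real_cond_exp M (gen_sigma M W R) (\<lambda>\<omega>. indicator A (U \<omega>)) \<omega> *
        real_cond_exp M (gen_sigma M W R) (\<lambda>\<omega>. indicator B (V \<omega>)) \<omega>)"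

end

theory Submission
  imports Defs
begin

text \<open>The first two bounds hold with equality before the mutual information bound is inserted: by the
  Markov property h(X2 | X1, Y) = h(X, Y) - h(Y) and h(Y' | X1, Y) = h(X, Y) - h(X).

  For the third, let p = X2 + Y, q = X1 + Y, r = X1 + Y' and s = X2 + Y' = p - q + r. Submodularity of
  entropy suggests h(s | X1, Y) + h(X2, Y, X1, Y') \<le> h(p) + h(q) + h(r) + h(X2) + h(Y'), and the
  Markov property gives h(X2, Y, X1, Y') = 3 h(X, Y) - h(X) - h(Y), hence the claim with 6 log K. Since
  the intermediate entropies need not be finite, this inequality is obtained from two applications of
  ln u \<le> u - 1, to density ratios u1, u2 of mean at most 1. With c the convolution of the densities
  of X and Y, u1 compares g(p) g(q) g(r) fX(X2) fY(Y') / c(s) with the density of (X2, Y, X1, Y'), and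
  u2 compares c(s) f(X1, Y) with the density of (s, X1, Y). In ln u1 + ln u2 the term ln c(s), whose
  integrability is unknown, cancels.\<close>

section \<open>Measures on products and the sigma-algebra generated by a variable\<close>

text \<open>Rectangles form an intersection-stable generator, and the whole space is itself a
  rectangle of finite measure, so a constant exhausting sequence suffices.\<close>

lemma measure_pair_eqI_Times:
  assumes sets: "sets M = sets (S \<Otimes>\<^sub>M T)" "sets N = sets (S \<Otimes>\<^sub>M T)"
    and fin: "emeasure M (space M) \<noteq> \<infinity>"
    and eq: "\<And>A B. A \<in> sets S \<Longrightarrow> B \<in> sets T \<Longrightarrow> emeasure M (A \<times> B) = emeasure N (A \<times> B)"
  shows "M = N"
proof (rule measure_eqI_generator_eq[OF Int_stable_pair_measure_generator[of S T],
      where \<Omega> = "space S \<times> space T" and A = "\<lambda>_. space S \<times> space T"])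
  show "{a \<times> b |a b. a \<in> sets S \<and> b \<in> sets T} \<subseteq> Pow (space S \<times> space T)"
    using sets.space_closed[of S] sets.space_closed[of T] by auto
  have "space M = space S \<times> space T"
    using sets_eq_imp_space_eq[OF sets(1)] by (simp add: space_pair_measure)
  then show "emeasure M (space S \<times> space T) \<noteq> \<infinity>"
    using fin by simp
qed (use sets eq in \<open>auto simp: sets_pair_measure\<close>)

lemma sets_gen_sigmaE:
  assumes "D \<in> sets (gen_sigma M W R)" "W \<in> measurable M R"
  obtains C where "C \<in> sets R" "D = W -` C \<inter> space M"
proof -
  have "W \<in> space M \<rightarrow> space R"
    using assms(2) by (auto dest: measurable_space)
  then show ?thesis
    using assms that by (auto simp: gen_sigma_def sets_vimage_algebra2)
qed

lemma vimage_in_gen_sigma: "C \<in> sets R \<Longrightarrow> W -` C \<inter> space M \<in> sets (gen_sigma M W R)"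
  unfolding gen_sigma_def by (rule in_vimage_algebra)

lemma measurable_gen_sigma:
  assumes "W \<in> measurable M R"
  shows "W \<in> measurable (gen_sigma M W R) R"
  unfolding gen_sigma_def using assms
  by (intro measurable_vimage_algebra1) (auto dest: measurable_space)

context prob_space
begin

lemma sigma_finite_subalgebra_gen_sigma:
  assumes "W \<in> measurable M R"
  shows "sigma_finite_subalgebra M (gen_sigma M W R)"
proof (rule finite_measure_subalgebra_is_sigma_finite)
  have "sets (gen_sigma M W R) \<subseteq> sets M"
  proof
    fix D assume "D \<in> sets (gen_sigma M W R)"
    then obtain C where "C \<in> sets R" "D = W -` C \<inter> space M"
      using assms by (rule sets_gen_sigmaE)
    then show "D \<in> sets M"
      using assms by (auto intro: measurable_sets)
  qed
  then have "subalgebra M (gen_sigma M W R)"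
    by (simp add: subalgebra_def gen_sigma_def)
  then show "finite_measure_subalgebra M (gen_sigma M W R)"
    by unfold_locales
qed

text \<open>The law of \<open>V\<close> gives no mass to the zeros of its own density. This licenses
  the product and quotient rules for \<open>ln\<close> of densities evaluated along random
  variables.\<close>

lemma distributed_AE_pos:
  fixes f :: "'b \<Rightarrow> real"
  assumes "distributed M S V (\<lambda>x. ennreal (f x))" and nn: "\<And>x. 0 \<le> f x"
  shows "AE \<omega> in M. 0 < f (V \<omega>)"
proof -
  have [measurable]: "f \<in> borel_measurable S"
    using assms by (intro distributed_real_measurable) auto
  show ?thesis
    by (subst distributed_AE2[OF assms(1)]) auto
qed

section \<open>Conditional densities and the joint density under conditional independence\<close>

context
  fixes S :: "'b measure" and R :: "'c measure" and U :: "'a \<Rightarrow> 'b" and W :: "'a \<Rightarrow> 'c"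
    and f :: "'b \<times> 'c \<Rightarrow> real" and w :: "'c \<Rightarrow> real"
  assumes S: "sigma_finite_measure S" and R: "sigma_finite_measure R"
    and UW: "distributed M (S \<Otimes>\<^sub>M R) (\<lambda>\<omega>. (U \<omega>, W \<omega>)) (\<lambda>x. ennreal (f x))"
    and f0: "\<And>x. 0 \<le> f x"
    and W: "distributed M R W (\<lambda>x. ennreal (w x))"
    and w0: "\<And>x. 0 \<le> w x"
begin

lemma cond_density_measurable:
  assumes [measurable]: "A \<in> sets S"
  shows "(\<lambda>z. \<integral>\<^sup>+u. indicator A u * ennreal (f (u, z) / w z) \<partial>S) \<in> borel_measurable R"
proof -
  interpret S: sigma_finite_measure S by (rule S)
  have [measurable]: "f \<in> borel_measurable (S \<Otimes>\<^sub>M R)" "w \<in> borel_measurable R"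
    using UW W f0 w0 by (auto intro: distributed_real_measurable)
  show ?thesis by measurable
qed

text \<open>The quotient \<open>f (u, z) / w z\<close> acts as the conditional density of
  \<open>U\<close> given \<open>W\<close>. Where \<open>w\<close> vanishes the quotient is 0 by
  convention, which is harmless because \<open>f\<close> vanishes there almost everywhere.\<close>

lemma nn_integral_cond_density:
  assumes [measurable]: "A \<in> sets S" "C \<in> sets R"
  shows "(\<integral>\<^sup>+\<omega>. indicator C (W \<omega>) * (\<integral>\<^sup>+u. indicator A u * ennreal (f (u, W \<omega>) / w (W \<omega>)) \<partial>S) \<partial>M)
    = (\<integral>\<^sup>+\<omega>. indicator A (U \<omega>) * indicator C (W \<omega>) \<partial>M)"
proof -
  interpret S: sigma_finite_measure S by (rule S)
  interpret R: sigma_finite_measure R by (rule R)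
  interpret SR: pair_sigma_finite S R ..
  have [measurable]: "f \<in> borel_measurable (S \<Otimes>\<^sub>M R)" "w \<in> borel_measurable R"
    using UW W f0 w0 by (auto intro: distributed_real_measurable)
  note cond_density_measurable[OF assms(1), measurable]
  have "AE x in S \<Otimes>\<^sub>M R. 0 < ennreal (f x) \<longrightarrow> 0 < w (snd x)"
    using distributed_AE_pos[OF W w0]
    by (subst distributed_AE2[OF UW, symmetric]) auto
  then have ae: "AE x in S \<Otimes>\<^sub>M R. ennreal (f x) = ennreal (w (snd x)) * ennreal (f x / w (snd x))"
    by eventually_elim (use f0 w0 in \<open>auto simp: ennreal_mult[symmetric] less_le\<close>)
  have "(\<integral>\<^sup>+\<omega>. indicator A (U \<omega>) * indicator C (W \<omega>) \<partial>M)
      = (\<integral>\<^sup>+x. ennreal (f x) * (indicator A (fst x) * indicator C (snd x)) \<partial>(S \<Otimes>\<^sub>M R))"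
    by (subst distributed_nn_integral[OF UW]) auto
  also have "\<dots> = (\<integral>\<^sup>+x. (ennreal (w (snd x)) * ennreal (f x / w (snd x))) *
      (indicator A (fst x) * indicator C (snd x)) \<partial>(S \<Otimes>\<^sub>M R))"
    using ae by (intro nn_integral_cong_AE) (auto elim: eventually_mono)
  also have "\<dots> = (\<integral>\<^sup>+z. \<integral>\<^sup>+u. (ennreal (w z) * indicator C z) * (indicator A u * ennreal (f (u, z) / w z)) \<partial>S \<partial>R)"
    by (subst SR.nn_integral_snd[symmetric]) (auto simp: ac_simps)
  also have "\<dots> = (\<integral>\<^sup>+z. ennreal (w z) * (indicator C z * (\<integral>\<^sup>+u. indicator A u * ennreal (f (u, z) / w z) \<partial>S)) \<partial>R)"
    by (intro nn_integral_cong) (subst nn_integral_cmult, auto simp: ac_simps)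
  also have "\<dots> = (\<integral>\<^sup>+\<omega>. indicator C (W \<omega>) * (\<integral>\<^sup>+u. indicator A u * ennreal (f (u, W \<omega>) / w (W \<omega>)) \<partial>S) \<partial>M)"
    by (subst distributed_nn_integral[OF W]) auto
  finally show ?thesis ..
qed

text \<open>With \<open>C\<close> the whole space, the mean of this integral is a probability, hence
  at most 1, and a nonnegative variable of finite mean is finite almost surely.\<close>

lemma cond_density_finite:
  assumes A: "A \<in> sets S"
  shows "AE \<omega> in M. (\<integral>\<^sup>+u. indicator A u * ennreal (f (u, W \<omega>) / w (W \<omega>)) \<partial>S) < \<infinity>"
proof -
  have [measurable]: "U \<in> measurable M S" "W \<in> measurable M R"
    using UW W by (auto dest: distributed_measurable)
  note cond_density_measurable[OF A, measurable] A[measurable]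
  have "(\<integral>\<^sup>+\<omega>. (\<integral>\<^sup>+u. indicator A u * ennreal (f (u, W \<omega>) / w (W \<omega>)) \<partial>S) \<partial>M)
    = (\<integral>\<^sup>+\<omega>. indicator (space R) (W \<omega>) * (\<integral>\<^sup>+u. indicator A u * ennreal (f (u, W \<omega>) / w (W \<omega>)) \<partial>S) \<partial>M)"
    by (intro nn_integral_cong) (auto dest!: measurable_space[OF \<open>W \<in> measurable M R\<close>])
  also have "\<dots> = (\<integral>\<^sup>+\<omega>. indicator A (U \<omega>) * indicator (space R) (W \<omega>) \<partial>M)"
    by (rule nn_integral_cond_density) (use A in auto)
  also have "\<dots> \<le> (\<integral>\<^sup>+\<omega>. 1 \<partial>M)"
    by (intro nn_integral_mono) (auto split: split_indicator)
  finally have "(\<integral>\<^sup>+\<omega>. (\<integral>\<^sup>+u. indicator A u * ennreal (f (u, W \<omega>) / w (W \<omega>)) \<partial>S) \<partial>M) \<le> 1"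
    by (simp add: emeasure_space_1)
  then have "(\<integral>\<^sup>+\<omega>. (\<integral>\<^sup>+u. indicator A u * ennreal (f (u, W \<omega>) / w (W \<omega>)) \<partial>S) \<partial>M) \<noteq> \<infinity>"
    by (auto simp: top_unique)
  from nn_integral_PInf_AE[OF _ this] show ?thesis
    by (auto simp: less_top)
qed

text \<open>Conditional expectations are characterised by their integrals over the sets of the
  conditioning sigma-algebra. These sets are preimages of some \<open>C\<close> under
  \<open>W\<close>, and \<open>nn_integral_cond_density\<close> computes the integrals over them.
  \<open>enn2real\<close> alters the value only on the null set where the inner integral is
  infinite.\<close>

lemma real_cond_exp_eq_cond_density:
  assumes A: "A \<in> sets S"
  shows "AE \<omega> in M. real_cond_exp M (gen_sigma M W R) (\<lambda>\<omega>. indicator A (U \<omega>)) \<omega>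
    = enn2real (\<integral>\<^sup>+u. indicator A u * ennreal (f (u, W \<omega>) / w (W \<omega>)) \<partial>S)"
proof -
  have [measurable]: "U \<in> measurable M S" and Wm [measurable]: "W \<in> measurable M R"
    using UW W by (auto dest: distributed_measurable)
  interpret G: sigma_finite_subalgebra M "gen_sigma M W R"
    by (rule sigma_finite_subalgebra_gen_sigma[OF Wm])
  define q where "q z = (\<integral>\<^sup>+u. indicator A u * ennreal (f (u, z) / w z) \<partial>S)" for z
  have [measurable]: "q \<in> borel_measurable R"
    unfolding q_def by (rule cond_density_measurable[OF A])
  note A[measurable]
  have fin: "AE \<omega> in M. q (W \<omega>) < \<infinity>"
    using cond_density_finite[OF A] by (simp add: q_def)
  have nn: "(\<integral>\<^sup>+\<omega>. ennreal (indicator C (W \<omega>) * enn2real (q (W \<omega>))) \<partial>M)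
      = (\<integral>\<^sup>+\<omega>. ennreal (indicator C (W \<omega>) * indicator A (U \<omega>)) \<partial>M)" if [measurable]: "C \<in> sets R" for C
  proof -
    have "(\<integral>\<^sup>+\<omega>. ennreal (indicator C (W \<omega>) * enn2real (q (W \<omega>))) \<partial>M)
        = (\<integral>\<^sup>+\<omega>. indicator C (W \<omega>) * q (W \<omega>) \<partial>M)"
      using fin by (intro nn_integral_cong_AE) (auto elim!: eventually_mono split: split_indicator)
    also have "\<dots> = (\<integral>\<^sup>+\<omega>. indicator A (U \<omega>) * indicator C (W \<omega>) \<partial>M)"
      unfolding q_def by (rule nn_integral_cond_density[OF A that])
    also have "\<dots> = (\<integral>\<^sup>+\<omega>. ennreal (indicator C (W \<omega>) * indicator A (U \<omega>)) \<partial>M)"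
      by (intro nn_integral_cong) (auto split: split_indicator)
    finally show ?thesis .
  qed
  have int: "integrable M (\<lambda>\<omega>. enn2real (q (W \<omega>)))"
  proof (rule integrableI_nonneg)
    have "(\<integral>\<^sup>+\<omega>. ennreal (enn2real (q (W \<omega>))) \<partial>M)
      = (\<integral>\<^sup>+\<omega>. ennreal (indicator (space R) (W \<omega>) * enn2real (q (W \<omega>))) \<partial>M)"
      by (intro nn_integral_cong) (auto dest!: measurable_space[OF Wm])
    also have "\<dots> \<le> (\<integral>\<^sup>+\<omega>. 1 \<partial>M)"
      unfolding nn[OF sets.top] by (intro nn_integral_mono) (auto split: split_indicator)
    finally show "(\<integral>\<^sup>+\<omega>. ennreal (enn2real (q (W \<omega>))) \<partial>M) < \<infinity>"
      by (simp add: emeasure_space_1 le_less_trans)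
  qed auto
  show ?thesis
    unfolding q_def[symmetric]
  proof (rule G.real_cond_exp_charact[OF _ _ int])
    show "integrable M (\<lambda>x. indicator A (U x) :: real)"
      by (rule integrable_const_bound[where B=1]) auto
    show "(\<lambda>\<omega>. enn2real (q (W \<omega>))) \<in> borel_measurable (gen_sigma M W R)"
      using measurable_gen_sigma[OF Wm] by measurable
    fix D assume "D \<in> sets (gen_sigma M W R)"
    then obtain C where C[measurable]: "C \<in> sets R" and D: "D = W -` C \<inter> space M"
      using Wm by (rule sets_gen_sigmaE)
    have *: "set_lebesgue_integral M D h = enn2real (\<integral>\<^sup>+\<omega>. ennreal (indicator C (W \<omega>) * h \<omega>) \<partial>M)"
      if [measurable]: "h \<in> borel_measurable M" and "\<And>\<omega>. 0 \<le> h \<omega>" for h :: "'a \<Rightarrow> real"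
    proof -
      have "set_lebesgue_integral M D h = (\<integral>\<omega>. indicator C (W \<omega>) * h \<omega> \<partial>M)"
        unfolding set_lebesgue_integral_def D
        by (intro Bochner_Integration.integral_cong) (auto split: split_indicator)
      also have "\<dots> = enn2real (\<integral>\<^sup>+\<omega>. ennreal (indicator C (W \<omega>) * h \<omega>) \<partial>M)"
        using that by (intro integral_eq_nn_integral) auto
      finally show ?thesis .
    qed
    show "set_lebesgue_integral M D (\<lambda>x. indicator A (U x))
      = set_lebesgue_integral M D (\<lambda>\<omega>. enn2real (q (W \<omega>)))"
      by (subst (1 2) *) (auto simp: nn[OF C])
  qed
qed

end

text \<open>Given \<open>W\<close>, the conditional density of the pair is the product of
  \<open>f / w\<close> and \<open>g / w\<close>; one factor \<open>w\<close> is restored on passing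
  to the joint law. The identity is first proved on boxes, where \<open>cond_indep\<close> applies
  directly, and then extended to general measurable sets.\<close>

lemma distributed_cond_indep:
  fixes f :: "'b \<times> 'd \<Rightarrow> real" and g :: "'c \<times> 'd \<Rightarrow> real" and w :: "'d \<Rightarrow> real"
  assumes S: "sigma_finite_measure S" and T: "sigma_finite_measure T" and R: "sigma_finite_measure R"
    and ci: "cond_indep M S U T V R W"
    and UW: "distributed M (S \<Otimes>\<^sub>M R) (\<lambda>\<omega>. (U \<omega>, W \<omega>)) (\<lambda>x. ennreal (f x))" and f0: "\<And>x. 0 \<le> f x"
    and VW: "distributed M (T \<Otimes>\<^sub>M R) (\<lambda>\<omega>. (V \<omega>, W \<omega>)) (\<lambda>x. ennreal (g x))" and g0: "\<And>x. 0 \<le> g x"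
    and W: "distributed M R W (\<lambda>x. ennreal (w x))" and w0: "\<And>x. 0 \<le> w x"
  shows "distributed M (S \<Otimes>\<^sub>M (T \<Otimes>\<^sub>M R)) (\<lambda>\<omega>. (U \<omega>, (V \<omega>, W \<omega>)))
    (\<lambda>(u, (v, z)). ennreal (f (u, z) * g (v, z) / w z))"
proof -
  interpret S: sigma_finite_measure S by (rule S)
  interpret T: sigma_finite_measure T by (rule T)
  interpret R: sigma_finite_measure R by (rule R)
  interpret SR: pair_sigma_finite S R ..
  interpret TR: pair_sigma_finite T R ..
  have TR: "sigma_finite_measure (T \<Otimes>\<^sub>M R)" by unfold_locales
  interpret STR: pair_sigma_finite S "T \<Otimes>\<^sub>M R" ..
  have Um[measurable]: "U \<in> measurable M S" and Vm[measurable]: "V \<in> measurable M T"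
    and Wm [measurable]: "W \<in> measurable M R"
    using UW VW W by (auto dest: distributed_measurable)
  have [measurable]: "f \<in> borel_measurable (S \<Otimes>\<^sub>M R)" "g \<in> borel_measurable (T \<Otimes>\<^sub>M R)"
     "w \<in> borel_measurable R"
    using UW VW W f0 w0 g0 by (auto intro: distributed_real_measurable)
  interpret G: sigma_finite_subalgebra M "gen_sigma M W R"
    by (rule sigma_finite_subalgebra_gen_sigma[OF Wm])
  let ?F = "\<lambda>(u, (v, z)). ennreal (f (u, z) * g (v, z) / w z)"
  have [measurable]: "?F \<in> borel_measurable (S \<Otimes>\<^sub>M (T \<Otimes>\<^sub>M R))"
    by measurable
  have rect: "emeasure M {\<omega> \<in> space M. U \<omega> \<in> A \<and> V \<omega> \<in> B \<and> W \<omega> \<in> C}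
    = (\<integral>\<^sup>+u. \<integral>\<^sup>+v. \<integral>\<^sup>+z. indicator A u * indicator B v * indicator C z * ?F (u, (v, z)) \<partial>R \<partial>T \<partial>S)"
    if A[measurable]: "A \<in> sets S" and B[measurable]: "B \<in> sets T" and C[measurable]: "C \<in> sets R" for A B C
  proof -
    define p where "p z = (\<integral>\<^sup>+u. indicator A u * ennreal (f (u, z) / w z) \<partial>S)" for z
    define q where "q z = (\<integral>\<^sup>+v. indicator B v * ennreal (g (v, z) / w z) \<partial>T)" for z
    have [measurable]: "p \<in> borel_measurable R" "q \<in> borel_measurable R"
      unfolding p_def q_def by measurable
    let ?E = "\<lambda>h. real_cond_exp M (gen_sigma M W R) h"
    let ?h = "\<lambda>\<omega>. indicator A (U \<omega>) * indicator B (V \<omega>) :: real"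
    have int: "integrable M ?h"
      by (rule integrable_const_bound[where B=1]) (auto split: split_indicator)
    \<comment> \<open>Finiteness of \<open>p\<close> and \<open>q\<close> at
      \<open>W \<omega>\<close> removes the \<open>enn2real\<close>, so the factorisation becomes an
      identity in \<open>ennreal\<close>.\<close>
    have ae: "AE \<omega> in M. ennreal (?E ?h \<omega>) = p (W \<omega>) * q (W \<omega>) \<and> 0 \<le> ?E ?h \<omega>"
      using ci[unfolded cond_indep_def, rule_format, OF A B]
        real_cond_exp_eq_cond_density[OF S R UW f0 W w0 A]
        real_cond_exp_eq_cond_density[OF T R VW g0 W w0 B]
        cond_density_finite[OF S R UW f0 W w0 A]
        cond_density_finite[OF T R VW g0 W w0 B]
      unfolding p_def[symmetric] q_def[symmetric]
      by eventually_elim (simp add: ennreal_mult)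
    let ?D = "W -` C \<inter> space M"
    have D: "?D \<in> sets (gen_sigma M W R)"
      by (rule vimage_in_gen_sigma[OF C])
    have "emeasure M {\<omega> \<in> space M. U \<omega> \<in> A \<and> V \<omega> \<in> B \<and> W \<omega> \<in> C}
        = ennreal (\<integral>\<omega>. indicator {\<omega> \<in> space M. U \<omega> \<in> A \<and> V \<omega> \<in> B \<and> W \<omega> \<in> C} \<omega> \<partial>M)"
      by (simp add: emeasure_eq_measure)
    also have "(\<integral>\<omega>. indicator {\<omega> \<in> space M. U \<omega> \<in> A \<and> V \<omega> \<in> B \<and> W \<omega> \<in> C} \<omega> \<partial>M) = (\<integral>\<omega>\<in>?D. ?h \<omega> \<partial>M)"
      unfolding set_lebesgue_integral_def
      by (intro Bochner_Integration.integral_cong) (auto split: split_indicator)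
    also have "\<dots> = (\<integral>\<omega>\<in>?D. ?E ?h \<omega> \<partial>M)"
      by (rule G.real_cond_exp_intA[OF int D])
    also have "ennreal \<dots> = (\<integral>\<^sup>+\<omega>. ennreal (indicator ?D \<omega> * ?E ?h \<omega>) \<partial>M)"
    proof (subst nn_integral_eq_integral)
      have "?D \<in> sets M" by measurable
      then show "integrable M (\<lambda>\<omega>. indicator ?D \<omega> * ?E ?h \<omega>)"
        using integrable_mult_indicator[OF _ G.real_cond_exp_int(1)[OF int]] by simp
      show "AE \<omega> in M. 0 \<le> indicator ?D \<omega> * ?E ?h \<omega>"
        using ae by eventually_elim simp
    qed (simp add: set_lebesgue_integral_def)
    also have "\<dots> = (\<integral>\<^sup>+\<omega>. indicator C (W \<omega>) * (p (W \<omega>) * q (W \<omega>)) \<partial>M)"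
      using ae AE_space
      by (intro nn_integral_cong_AE) (auto elim!: eventually_elim2 split: split_indicator)
    also have "\<dots> = (\<integral>\<^sup>+z. ennreal (w z) * (indicator C z * (p z * q z)) \<partial>R)"
      by (subst distributed_nn_integral[OF W]) auto
    also have "\<dots> = (\<integral>\<^sup>+z. \<integral>\<^sup>+v. \<integral>\<^sup>+u. indicator A u * indicator B v * indicator C z * ?F (u, (v, z)) \<partial>S \<partial>T \<partial>R)"
    proof (intro nn_integral_cong)
      fix z assume [measurable]: "z \<in> space R"
      \<comment> \<open>Where \<open>w z = 0\<close> both sides are 0: the left one by the
        convention for division, the right one through the factor \<open>w z\<close>.\<close>
      have eq: "indicator A u * indicator B v * indicator C z * ?F (u, (v, z))
        = ennreal (w z) * indicator C z * (indicator B v * ennreal (g (v, z) / w z)) * (indicator A u * ennreal (f (u, z) / w z))" for u v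
        using f0[of "(u,z)"] g0[of "(v,z)"] w0[of z]
        by (cases "w z = 0") (auto simp: ennreal_mult[symmetric] field_simps split: split_indicator)
      show "ennreal (w z) * (indicator C z * (p z * q z)) =
        (\<integral>\<^sup>+v. \<integral>\<^sup>+u. indicator A u * indicator B v * indicator C z * ?F (u, (v, z)) \<partial>S \<partial>T)"
        unfolding eq p_def q_def
        by (subst nn_integral_cmult, measurable, subst nn_integral_multc, measurable,
            subst nn_integral_cmult, measurable) (simp add: ac_simps)
    qed
    also have "\<dots> = (\<integral>\<^sup>+v. \<integral>\<^sup>+z. \<integral>\<^sup>+u. indicator A u * indicator B v * indicator C z * ?F (u, (v, z)) \<partial>S \<partial>R \<partial>T)"
      by (rule TR.Fubini') measurable
    also have "\<dots> = (\<integral>\<^sup>+x. \<integral>\<^sup>+u. indicator A u * indicator B (fst x) * indicator C (snd x) * ?F (u, x) \<partial>S \<partial>(T \<Otimes>\<^sub>M R))"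
      by (subst R.nn_integral_fst[symmetric]) (auto simp: split_beta')
    also have "\<dots> = (\<integral>\<^sup>+u. \<integral>\<^sup>+x. indicator A u * indicator B (fst x) * indicator C (snd x) * ?F (u, x) \<partial>(T \<Otimes>\<^sub>M R) \<partial>S)"
      by (rule STR.Fubini') measurable
    also have "\<dots> = (\<integral>\<^sup>+u. \<integral>\<^sup>+v. \<integral>\<^sup>+z. indicator A u * indicator B v * indicator C z * ?F (u, (v, z)) \<partial>R \<partial>T \<partial>S)"
      by (intro nn_integral_cong) (subst R.nn_integral_fst[symmetric], auto simp: split_beta')
    finally show ?thesis .
  qed
  \<comment> \<open>\<open>distributed_jointI\<close> asks for arbitrary measurable \<open>D\<close>
    in the product of \<open>T\<close> and \<open>R\<close>. With \<open>A\<close> fixed, both sides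
    are measures in \<open>D\<close> that agree on rectangles by \<open>rect\<close>, hence
    everywhere.\<close>
  have "emeasure M {\<omega> \<in> space M. U \<omega> \<in> A \<and> (V \<omega>, W \<omega>) \<in> D}
    = (\<integral>\<^sup>+u. (\<integral>\<^sup>+x. ?F (u, x) * indicator D x \<partial>(T \<Otimes>\<^sub>M R)) * indicator A u \<partial>S)"
    if A[measurable]: "A \<in> sets S" and D[measurable]: "D \<in> sets (T \<Otimes>\<^sub>M R)" for A D
  proof -
    let ?N = "T \<Otimes>\<^sub>M R"
    let ?L = "distr (density M (\<lambda>\<omega>. indicator A (U \<omega>))) ?N (\<lambda>\<omega>. (V \<omega>, W \<omega>))"
    let ?R = "density ?N (\<lambda>x. \<integral>\<^sup>+u. indicator A u * ?F (u, x) \<partial>S)"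
    have L: "emeasure ?L Q = emeasure M {\<omega> \<in> space M. U \<omega> \<in> A \<and> (V \<omega>, W \<omega>) \<in> Q}"
      if [measurable]: "Q \<in> sets ?N" for Q
    proof -
      have "emeasure ?L Q = (\<integral>\<^sup>+\<omega>. indicator A (U \<omega>) * indicator ((\<lambda>\<omega>. (V \<omega>, W \<omega>)) -` Q \<inter> space M) \<omega> \<partial>M)"
        by (subst emeasure_distr, simp, simp, subst emeasure_density) auto
      also have "\<dots> = (\<integral>\<^sup>+\<omega>. indicator {\<omega> \<in> space M. U \<omega> \<in> A \<and> (V \<omega>, W \<omega>) \<in> Q} \<omega> \<partial>M)"
        by (intro nn_integral_cong) (auto split: split_indicator)
      also have "\<dots> = emeasure M {\<omega> \<in> space M. U \<omega> \<in> A \<and> (V \<omega>, W \<omega>) \<in> Q}"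
        by (rule nn_integral_indicator) measurable
      finally show ?thesis .
    qed
    have Rm: "emeasure ?R Q = (\<integral>\<^sup>+u. \<integral>\<^sup>+x. indicator A u * indicator Q x * ?F (u, x) \<partial>?N \<partial>S)"
      if [measurable]: "Q \<in> sets ?N" for Q
    proof -
      have "emeasure ?R Q = (\<integral>\<^sup>+x. \<integral>\<^sup>+u. indicator A u * indicator Q x * ?F (u, x) \<partial>S \<partial>?N)"
        by (subst emeasure_density, measurable, intro nn_integral_cong, subst nn_integral_multc[symmetric])
           (auto simp: ac_simps)
      also have "\<dots> = (\<integral>\<^sup>+u. \<integral>\<^sup>+x. indicator A u * indicator Q x * ?F (u, x) \<partial>?N \<partial>S)"
        by (rule STR.Fubini') measurable
      finally show ?thesis .
    qed
    have "?L = ?R"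
    proof (rule measure_pair_eqI_Times)
      show "emeasure ?L (space ?L) \<noteq> \<infinity>"
        by (subst L) auto
      fix B C assume [measurable]: "B \<in> sets T" "C \<in> sets R"
      show "emeasure ?L (B \<times> C) = emeasure ?R (B \<times> C)"
      proof -
        have "emeasure ?L (B \<times> C) = emeasure M {\<omega> \<in> space M. U \<omega> \<in> A \<and> V \<omega> \<in> B \<and> W \<omega> \<in> C}"
          by (subst L) auto
        also have "\<dots> = (\<integral>\<^sup>+u. \<integral>\<^sup>+v. \<integral>\<^sup>+z. indicator A u * indicator B v * indicator C z * ?F (u, (v, z)) \<partial>R \<partial>T \<partial>S)"
          by (rule rect) measurable
        also have "\<dots> = (\<integral>\<^sup>+u. \<integral>\<^sup>+x. indicator A u * indicator (B \<times> C) x * ?F (u, x) \<partial>?N \<partial>S)"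
          by (intro nn_integral_cong, subst R.nn_integral_fst[symmetric])
             (auto simp: indicator_times ac_simps split_beta')
        also have "\<dots> = emeasure ?R (B \<times> C)"
          by (rule Rm[symmetric]) simp
        finally show ?thesis .
      qed
    qed auto
    then have "emeasure ?L D = emeasure ?R D" by simp
    also have "\<dots> = (\<integral>\<^sup>+u. (\<integral>\<^sup>+x. ?F (u, x) * indicator D x \<partial>?N) * indicator A u \<partial>S)"
      unfolding Rm[OF D]
      by (intro nn_integral_cong, subst nn_integral_multc[symmetric]) (auto simp: ac_simps)
    finally show ?thesis
      by (simp add: L)
  qed
  then show ?thesis
    by (intro distributed_jointI[OF S TR]) auto
qed

end

section \<open>Convolution of densities on the real line\<close>

text \<open>Values in \<open>ennreal\<close> make the convolution of nonnegative functions defined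
  at every point, with infinity allowed.\<close>

definition nn_conv :: "(real \<Rightarrow> ennreal) \<Rightarrow> (real \<Rightarrow> ennreal) \<Rightarrow> real \<Rightarrow> ennreal" where
  "nn_conv a b s = (\<integral>\<^sup>+x. a x * b (s - x) \<partial>lborel)"

lemma nn_conv_measurable [measurable]:
  assumes [measurable]: "a \<in> borel_measurable borel" "b \<in> borel_measurable borel"
  shows "nn_conv a b \<in> borel_measurable borel"
  unfolding nn_conv_def by measurable

lemma nn_integral_lborel_shift:
  fixes h :: "real \<Rightarrow> ennreal"
  assumes "h \<in> borel_measurable borel"
  shows "(\<integral>\<^sup>+x. h (x + t) \<partial>lborel) = (\<integral>\<^sup>+x. h x \<partial>lborel)"
  using nn_integral_real_affine[OF assms, of 1 t] by (simp add: add.commute)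

lemma nn_integral_lborel_reflect:
  fixes h :: "real \<Rightarrow> ennreal"
  assumes "h \<in> borel_measurable borel"
  shows "(\<integral>\<^sup>+x. h (t - x) \<partial>lborel) = (\<integral>\<^sup>+x. h x \<partial>lborel)"
  using nn_integral_real_affine[OF assms, of "-1" t] by simp

text \<open>For fixed \<open>x\<close> substitute \<open>s = x + y\<close>, with Tonelli before and
  after. For probability densities this is the expectation of \<open>h\<close> at a sum of
  independent variables.\<close>

lemma nn_integral_nn_conv:
  assumes [measurable]: "a \<in> borel_measurable borel" "b \<in> borel_measurable borel" "h \<in> borel_measurable borel"
  shows "(\<integral>\<^sup>+y. \<integral>\<^sup>+x. a x * b y * h (x + y) \<partial>lborel \<partial>lborel) = (\<integral>\<^sup>+s. nn_conv a b s * h s \<partial>lborel)"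
proof -
  have "(\<integral>\<^sup>+y. \<integral>\<^sup>+x. a x * b y * h (x + y) \<partial>lborel \<partial>lborel)
      = (\<integral>\<^sup>+x. \<integral>\<^sup>+y. a x * b y * h (x + y) \<partial>lborel \<partial>lborel)"
    by (rule lborel_pair.Fubini') measurable
  also have "\<dots> = (\<integral>\<^sup>+x. \<integral>\<^sup>+s. a x * b (s - x) * h s \<partial>lborel \<partial>lborel)"
  proof (rule nn_integral_cong)
    fix x :: real
    show "(\<integral>\<^sup>+y. a x * b y * h (x + y) \<partial>lborel) = (\<integral>\<^sup>+s. a x * b (s - x) * h s \<partial>lborel)"
      using nn_integral_lborel_shift[of "\<lambda>s. a x * b (s - x) * h s" x] by (simp add: add.commute)
  qed
  also have "\<dots> = (\<integral>\<^sup>+s. \<integral>\<^sup>+x. a x * b (s - x) * h s \<partial>lborel \<partial>lborel)"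
    by (rule lborel_pair.Fubini') measurable
  also have "\<dots> = (\<integral>\<^sup>+s. nn_conv a b s * h s \<partial>lborel)"
    unfolding nn_conv_def by (intro nn_integral_cong nn_integral_multc) measurable
  finally show ?thesis .
qed

lemma nn_integral_nn_conv_1:
  assumes [measurable]: "a \<in> borel_measurable borel" "b \<in> borel_measurable borel"
    and "(\<integral>\<^sup>+x. a x \<partial>lborel) = 1" "(\<integral>\<^sup>+x. b x \<partial>lborel) = 1"
  shows "(\<integral>\<^sup>+s. nn_conv a b s \<partial>lborel) = 1"
proof -
  have "(\<integral>\<^sup>+s. nn_conv a b s \<partial>lborel) = (\<integral>\<^sup>+y. \<integral>\<^sup>+x. a x * b y \<partial>lborel \<partial>lborel)"
    using nn_integral_nn_conv[of a b "\<lambda>_. 1"] by simp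
  also have "\<dots> = (\<integral>\<^sup>+y. b y \<partial>lborel)"
    using assms by (simp add: nn_integral_multc)
  finally show ?thesis using assms by simp
qed

text \<open>Tested against the indicator of its own zero set, the convolution integrates to 0, so by
  \<open>nn_integral_nn_conv\<close> the product \<open>a x * b y\<close> vanishes at almost every
  pair whose sum lies in that set.\<close>

lemma AE_nn_conv_pos:
  assumes [measurable]: "a \<in> borel_measurable borel" "b \<in> borel_measurable borel"
  shows "AE y in lborel. AE x in lborel. 0 < a x \<longrightarrow> 0 < b y \<longrightarrow> 0 < nn_conv a b (x + y)"
proof -
  let ?h = "\<lambda>s. indicator {s. nn_conv a b s = 0} s :: ennreal"
  have "(\<integral>\<^sup>+y. \<integral>\<^sup>+x. a x * b y * ?h (x + y) \<partial>lborel \<partial>lborel) = (\<integral>\<^sup>+s. nn_conv a b s * ?h s \<partial>lborel)"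
    by (rule nn_integral_nn_conv) measurable
  also have "\<dots> = (\<integral>\<^sup>+s. 0 \<partial>(lborel :: real measure))"
    by (intro nn_integral_cong) (auto split: split_indicator)
  finally have "(\<integral>\<^sup>+y. \<integral>\<^sup>+x. a x * b y * ?h (x + y) \<partial>lborel \<partial>lborel) = 0"
    by simp
  then have "AE y in lborel. (\<integral>\<^sup>+x. a x * b y * ?h (x + y) \<partial>lborel) = 0"
    by (subst (asm) nn_integral_0_iff_AE) auto
  then show ?thesis
  proof eventually_elim
    case (elim y)
    then have "AE x in lborel. a x * b y * ?h (x + y) = 0"
      by (subst (asm) nn_integral_0_iff_AE) auto
    then show ?case
      by eventually_elim (auto simp: zero_less_iff_neq_zero split: split_indicator_asm)
  qed
qed

lemma nn_integral_lborel_prod4: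
  fixes h :: "real \<times> (real \<times> real) \<times> real \<Rightarrow> ennreal"
  assumes [measurable]: "h \<in> borel_measurable (lborel \<Otimes>\<^sub>M ((lborel \<Otimes>\<^sub>M lborel) \<Otimes>\<^sub>M lborel))"
  shows "(\<integral>\<^sup>+x. h x \<partial>(lborel \<Otimes>\<^sub>M ((lborel \<Otimes>\<^sub>M lborel) \<Otimes>\<^sub>M lborel)))
    = (\<integral>\<^sup>+u. \<integral>\<^sup>+v. \<integral>\<^sup>+w. \<integral>\<^sup>+z. h (u, ((v, w), z)) \<partial>lborel \<partial>lborel \<partial>lborel \<partial>lborel)"
proof -
  have sf3: "sigma_finite_measure (((lborel :: real measure) \<Otimes>\<^sub>M (lborel :: real measure)) \<Otimes>\<^sub>M (lborel :: real measure))"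
    unfolding lborel_prod by (rule lborel.sigma_finite_measure_axioms)
  have "(\<integral>\<^sup>+x. h x \<partial>(lborel \<Otimes>\<^sub>M ((lborel \<Otimes>\<^sub>M lborel) \<Otimes>\<^sub>M lborel)))
      = (\<integral>\<^sup>+u. \<integral>\<^sup>+x. h (u, x) \<partial>((lborel \<Otimes>\<^sub>M lborel) \<Otimes>\<^sub>M lborel) \<partial>lborel)"
    by (rule sigma_finite_measure.nn_integral_fst[OF sf3, symmetric]) measurable
  also have "\<dots> = (\<integral>\<^sup>+u. \<integral>\<^sup>+x. \<integral>\<^sup>+z. h (u, (x, z)) \<partial>lborel \<partial>(lborel \<Otimes>\<^sub>M lborel) \<partial>lborel)"
    by (rule nn_integral_cong, rule lborel.nn_integral_fst[symmetric]) measurable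
  also have "\<dots> = (\<integral>\<^sup>+u. \<integral>\<^sup>+v. \<integral>\<^sup>+w. \<integral>\<^sup>+z. h (u, ((v, w), z)) \<partial>lborel \<partial>lborel \<partial>lborel \<partial>lborel)"
    by (rule nn_integral_cong, rule lborel.nn_integral_fst[symmetric]) measurable
  finally show ?thesis .
qed

text \<open>Fubini lifts \<open>AE_nn_conv_pos\<close> to four coordinates, ordered
  \<open>(y', ((x2, y), x1))\<close> as in the density of the Markov chain: \<open>a\<close> is read
  at \<open>x2\<close> and \<open>b\<close> at \<open>y'\<close>, the other two coordinates are
  free.\<close>

lemma AE_nn_conv_pos_path:
  assumes [measurable]: "a \<in> borel_measurable borel" "b \<in> borel_measurable borel"
  shows "AE x in lborel \<Otimes>\<^sub>M ((lborel \<Otimes>\<^sub>M (lborel :: real measure)) \<Otimes>\<^sub>M (lborel :: real measure)).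
    0 < a (fst (fst (snd x))) \<longrightarrow> 0 < b (fst x) \<longrightarrow> 0 < nn_conv a b (fst (fst (snd x)) + fst x)"
proof -
  have sf: "sigma_finite_measure (lborel :: real measure)"
    by (rule lborel.sigma_finite_measure_axioms)
  have sf2: "sigma_finite_measure ((lborel :: real measure) \<Otimes>\<^sub>M (lborel :: real measure))"
    unfolding lborel_prod by (rule lborel.sigma_finite_measure_axioms)
  have sf3: "sigma_finite_measure (((lborel :: real measure) \<Otimes>\<^sub>M (lborel :: real measure)) \<Otimes>\<^sub>M (lborel :: real measure))"
    unfolding lborel_prod by (rule lborel.sigma_finite_measure_axioms)
  have "AE x in (lborel \<Otimes>\<^sub>M (lborel :: real measure)) \<Otimes>\<^sub>M (lborel :: real measure).
      0 < a (fst (fst x)) \<longrightarrow> 0 < b y \<longrightarrow> 0 < nn_conv a b (fst (fst x) + y)"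
    if y: "AE x in lborel. 0 < a x \<longrightarrow> 0 < b y \<longrightarrow> 0 < nn_conv a b (x + y)" for y
  proof (rule pair_sigma_finite.AE_pair_measure[OF pair_sigma_finite.intro[OF sf2 sf]])
    have "AE z in lborel \<Otimes>\<^sub>M (lborel :: real measure). 0 < a (fst z) \<longrightarrow> 0 < b y \<longrightarrow> 0 < nn_conv a b (fst z + y)"
    proof (rule pair_sigma_finite.AE_pair_measure[OF pair_sigma_finite.intro[OF sf sf]])
      show "AE x in lborel. AE x' in (lborel :: real measure). 0 < a (fst (x, x')) \<longrightarrow> 0 < b y \<longrightarrow> 0 < nn_conv a b (fst (x, x') + y)"
        using y by eventually_elim simp
    qed measurable
    then show "AE z in lborel \<Otimes>\<^sub>M (lborel :: real measure). AE x' in (lborel :: real measure).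
      0 < a (fst (fst (z, x'))) \<longrightarrow> 0 < b y \<longrightarrow> 0 < nn_conv a b (fst (fst (z, x')) + y)"
      by eventually_elim simp
  qed measurable
  then have "AE y in lborel. AE x in (lborel \<Otimes>\<^sub>M (lborel :: real measure)) \<Otimes>\<^sub>M (lborel :: real measure).
      0 < a (fst (fst x)) \<longrightarrow> 0 < b y \<longrightarrow> 0 < nn_conv a b (fst (fst x) + y)"
    by (rule eventually_mono[OF AE_nn_conv_pos[OF assms]])
  then have ae: "AE y in lborel. AE x in (lborel \<Otimes>\<^sub>M (lborel :: real measure)) \<Otimes>\<^sub>M (lborel :: real measure).
      0 < a (fst (fst (snd (y, x)))) \<longrightarrow> 0 < b (fst (y, x)) \<longrightarrow> 0 < nn_conv a b (fst (fst (snd (y, x))) + fst (y, x))"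
    by simp
  show ?thesis
    by (rule pair_sigma_finite.AE_pair_measure[OF pair_sigma_finite.intro[OF sf sf3] _ ae]) measurable
qed

text \<open>At the values 0 and infinity \<open>enn2real\<close> gives 0, hence so does its
  reciprocal, and the product is 0; at all other values it is 1.\<close>

lemma nn_conv_mult_inverse_le_1: "nn_conv a b s * ennreal (1 / enn2real (nn_conv a b s)) \<le> 1"
proof (cases "nn_conv a b s")
  case (real r)
  then show ?thesis
    by (cases "r = 0") (auto simp: ennreal_mult[symmetric])
qed simp

text \<open>In the coordinates p = x2 + y, r = x1 + y', s = x2 + y' and x2 the x2-integral produces the convolution of a and b at s, which the
  last factor cancels.\<close>

lemma nn_integral_path_le_1:
  fixes g a b :: "real \<Rightarrow> ennreal"
  assumes [measurable]: "g \<in> borel_measurable borel" "a \<in> borel_measurable borel" "b \<in> borel_measurable borel"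
    and g1: "(\<integral>\<^sup>+x. g x \<partial>lborel) = 1"
  shows "(\<integral>\<^sup>+y'. \<integral>\<^sup>+x2. \<integral>\<^sup>+y. \<integral>\<^sup>+x1. a x2 * b y' * ennreal (1 / enn2real (nn_conv a b (x2 + y'))) *
    (g (x2 + y) * (g (x1 + y) * g (x1 + y'))) \<partial>lborel \<partial>lborel \<partial>lborel \<partial>lborel) \<le> 1"
proof -
  let ?k = "\<lambda>s. ennreal (1 / enn2real (nn_conv a b s))"
  \<comment> \<open>What remains of the three \<open>g\<close> factors at fixed
    \<open>s = x2 + y'\<close>: with \<open>p = x2 + y\<close> and \<open>r = x1 + y'\<close> the
    third sum is \<open>x1 + y = p + r - s\<close>.\<close>
  define L where "L s = (\<integral>\<^sup>+p. \<integral>\<^sup>+r. g p * (g (p + r - s) * g r) \<partial>lborel \<partial>lborel)" for s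
  have [measurable]: "L \<in> borel_measurable borel"
    unfolding L_def by measurable
  \<comment> \<open>For fixed \<open>x2\<close> and \<open>y'\<close> the change of variables
    consists of two translations, \<open>r = x1 + y'\<close> and then
    \<open>p = x2 + y\<close>.\<close>
  have inner: "(\<integral>\<^sup>+y. \<integral>\<^sup>+x1. g (x2 + y) * (g (x1 + y) * g (x1 + y')) \<partial>lborel \<partial>lborel) = L (x2 + y')" for x2 y'
  proof -
    have "L (x2 + y') = (\<integral>\<^sup>+p. \<integral>\<^sup>+x1. g p * (g (x1 + (p - x2)) * g (x1 + y')) \<partial>lborel \<partial>lborel)"
      unfolding L_def
    proof (rule nn_integral_cong)
      fix p :: real
      show "(\<integral>\<^sup>+r. g p * (g (p + r - (x2 + y')) * g r) \<partial>lborel)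
          = (\<integral>\<^sup>+x1. g p * (g (x1 + (p - x2)) * g (x1 + y')) \<partial>lborel)"
        using nn_integral_lborel_shift[of "\<lambda>r. g p * (g (p + r - (x2 + y')) * g r)" y']
        by (simp add: algebra_simps)
    qed
    also have "\<dots> = (\<integral>\<^sup>+y. \<integral>\<^sup>+x1. g (x2 + y) * (g (x1 + y) * g (x1 + y')) \<partial>lborel \<partial>lborel)"
      using nn_integral_lborel_shift[of "\<lambda>p. \<integral>\<^sup>+x1. g p * (g (x1 + (p - x2)) * g (x1 + y')) \<partial>lborel" x2]
      by (simp add: add.commute)
    finally show ?thesis ..
  qed
  \<comment> \<open>When \<open>s\<close> is integrated first, the middle factor is a reflected and
    shifted copy of \<open>g\<close>, so each of the three factors contributes 1.\<close>
  have L1: "(\<integral>\<^sup>+s. L s \<partial>lborel) = 1"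
  proof -
    have "(\<integral>\<^sup>+s. L s \<partial>lborel) = (\<integral>\<^sup>+p. \<integral>\<^sup>+s. \<integral>\<^sup>+r. g p * (g (p + r - s) * g r) \<partial>lborel \<partial>lborel \<partial>lborel)"
      unfolding L_def by (rule lborel_pair.Fubini') measurable
    also have "\<dots> = (\<integral>\<^sup>+p. \<integral>\<^sup>+r. \<integral>\<^sup>+s. g p * (g (p + r - s) * g r) \<partial>lborel \<partial>lborel \<partial>lborel)"
      by (intro nn_integral_cong lborel_pair.Fubini') measurable
    also have "\<dots> = (\<integral>\<^sup>+p. \<integral>\<^sup>+r. g p * g r \<partial>lborel \<partial>lborel)"
      by (intro nn_integral_cong)
         (simp add: nn_integral_cmult nn_integral_multc nn_integral_lborel_reflect g1)
    also have "\<dots> = 1"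
      by (simp add: nn_integral_cmult g1)
    finally show ?thesis .
  qed
  have "(\<integral>\<^sup>+y'. \<integral>\<^sup>+x2. \<integral>\<^sup>+y. \<integral>\<^sup>+x1. a x2 * b y' * ?k (x2 + y') *
      (g (x2 + y) * (g (x1 + y) * g (x1 + y'))) \<partial>lborel \<partial>lborel \<partial>lborel \<partial>lborel)
      = (\<integral>\<^sup>+y'. \<integral>\<^sup>+x2. a x2 * b y' * (?k (x2 + y') * L (x2 + y')) \<partial>lborel \<partial>lborel)"
  proof (intro nn_integral_cong)
    fix y' x2 :: real
    show "(\<integral>\<^sup>+y. \<integral>\<^sup>+x1. a x2 * b y' * ?k (x2 + y') *
        (g (x2 + y) * (g (x1 + y) * g (x1 + y'))) \<partial>lborel \<partial>lborel) = a x2 * b y' * (?k (x2 + y') * L (x2 + y'))"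
      unfolding inner[symmetric]
      by (subst nn_integral_cmult, measurable, subst nn_integral_cmult, measurable) (simp add: mult.assoc)
  qed
  also have "\<dots> = (\<integral>\<^sup>+s. nn_conv a b s * (?k s * L s) \<partial>lborel)"
    by (rule nn_integral_nn_conv) measurable
  also have "\<dots> \<le> (\<integral>\<^sup>+s. 1 * L s \<partial>lborel)"
    unfolding mult.assoc[symmetric]
    by (intro nn_integral_mono mult_right_mono nn_conv_mult_inverse_le_1) simp
  finally show ?thesis
    by (simp add: L1)
qed

section \<open>Transport of conditional independence, laws and coordinates\<close>

lemma cond_indep_sym:
  assumes "cond_indep M S U T V R W"
  shows "cond_indep M T V S U R W"
  using assms unfolding cond_indep_def by (simp add: mult.commute)

text \<open>Test sets \<open>UNIV \<times> B\<close> leave the first component unrestricted. This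
  drops \<open>X\<^sub>2\<close> from the second Markov relation.\<close>

lemma cond_indep_snd:
  assumes ci: "cond_indep M S U (T \<Otimes>\<^sub>M T') (\<lambda>\<omega>. (V \<omega>, V' \<omega>)) R W"
    and V: "V \<in> measurable M T" "space T = UNIV"
  shows "cond_indep M S U T' V' R W"
  unfolding cond_indep_def
proof (intro ballI)
  fix A B assume "A \<in> sets S" and B: "B \<in> sets T'"
  moreover have "UNIV \<times> B \<in> sets (T \<Otimes>\<^sub>M T')"
    using B V sets.top[of T] by auto
  ultimately show "AE \<omega> in M.
        real_cond_exp M (gen_sigma M W R) (\<lambda>\<omega>. indicator A (U \<omega>) * indicator B (V' \<omega>)) \<omega> =
        real_cond_exp M (gen_sigma M W R) (\<lambda>\<omega>. indicator A (U \<omega>)) \<omega> *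
        real_cond_exp M (gen_sigma M W R) (\<lambda>\<omega>. indicator B (V' \<omega>)) \<omega>"
    using ci[unfolded cond_indep_def, rule_format, of A "UNIV \<times> B"]
    by (simp add: indicator_times)
qed

text \<open>Equal laws have equal images under \<open>t\<close>. With \<open>t\<close> the identity,
  a projection or the sum, densities carry over from \<open>(X, Y)\<close> to each of the three
  pairs of the chain.\<close>

lemma distributed_transform_distr_eq:
  assumes eq: "distr M N V = distr M N V'"
    and V: "V \<in> measurable M N" "V' \<in> measurable M N" and t: "t \<in> measurable N P"
    and d: "distributed M P (\<lambda>\<omega>. t (V' \<omega>)) d"
  shows "distributed M P (\<lambda>\<omega>. t (V \<omega>)) d"
proof -
  have "distr M P (\<lambda>\<omega>. t (V \<omega>)) = distr M P (\<lambda>\<omega>. t (V' \<omega>))"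
    using distr_distr[OF t V(1)] distr_distr[OF t V(2)] eq by (simp add: comp_def)
  then show ?thesis
    using d measurable_compose[OF V(1) t] by (simp add: distributed_def)
qed

text \<open>Both expectations are the same integral over \<open>S\<close> against \<open>f\<close>.
  This identifies expectations of log densities along the chain with those of the original
  pair.\<close>

lemma
  fixes f :: "'b \<Rightarrow> real"
  assumes "distributed M S V (\<lambda>x. ennreal (f x))" "distributed M S V' (\<lambda>x. ennreal (f x))"
    and "\<And>x. 0 \<le> f x" "h \<in> borel_measurable S"
  shows integrable_distributed_eq: "integrable M (\<lambda>\<omega>. h (V \<omega>) :: real) \<longleftrightarrow> integrable M (\<lambda>\<omega>. h (V' \<omega>))"
    and integral_distributed_eq: "(\<integral>\<omega>. h (V \<omega>) \<partial>M) = (\<integral>\<omega>. h (V' \<omega>) \<partial>M)"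
  using assms distributed_integrable[of M S V f h] distributed_integrable[of M S V' f h]
    distributed_integral[of M S V f h] distributed_integral[of M S V' f h] by auto

context prob_space
begin

text \<open>\<open>distributed_cond_indep\<close> puts the conditioning variable last, while the
  conditional entropy of \<open>Y'\<close> needs the conditioning variable \<open>X\<^sub>1\<close>
  in the middle, before \<open>Ym\<close>.\<close>

lemma distributed_swap_snd:
  assumes S: "sigma_finite_measure S" and T: "sigma_finite_measure T" and R: "sigma_finite_measure R"
    and d: "distributed M (S \<Otimes>\<^sub>M (T \<Otimes>\<^sub>M R)) (\<lambda>\<omega>. (U \<omega>, (V \<omega>, W \<omega>))) F"
  shows "distributed M (S \<Otimes>\<^sub>M (R \<Otimes>\<^sub>M T)) (\<lambda>\<omega>. (U \<omega>, (W \<omega>, V \<omega>))) (\<lambda>(u, (z, v)). F (u, (v, z)))"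
proof -
  interpret S: sigma_finite_measure S by (rule S)
  interpret T: sigma_finite_measure T by (rule T)
  interpret R: sigma_finite_measure R by (rule R)
  interpret TR: pair_sigma_finite T R ..
  interpret RT: pair_sigma_finite R T ..
  have TR: "sigma_finite_measure (T \<Otimes>\<^sub>M R)" and RT: "sigma_finite_measure (R \<Otimes>\<^sub>M T)" by unfold_locales
  have UVW: "(\<lambda>\<omega>. (U \<omega>, (V \<omega>, W \<omega>))) \<in> measurable M (S \<Otimes>\<^sub>M (T \<Otimes>\<^sub>M R))"
    using d by (rule distributed_measurable)
  have [measurable]: "U \<in> measurable M S" "V \<in> measurable M T" "W \<in> measurable M R"
    using measurable_compose[OF UVW measurable_fst]
      measurable_compose[OF measurable_compose[OF UVW measurable_snd] measurable_fst]
      measurable_compose[OF measurable_compose[OF UVW measurable_snd] measurable_snd] by simp_all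
  have [measurable]: "F \<in> borel_measurable (S \<Otimes>\<^sub>M (T \<Otimes>\<^sub>M R))"
    using d by (rule distributed_borel_measurable)
  show ?thesis
  proof (rule distributed_jointI[OF S RT])
    fix A D assume [measurable]: "A \<in> sets S" "D \<in> sets (R \<Otimes>\<^sub>M T)"
    have "emeasure M {\<omega> \<in> space M. U \<omega> \<in> A \<and> (W \<omega>, V \<omega>) \<in> D}
      = (\<integral>\<^sup>+\<omega>. indicator {\<omega> \<in> space M. U \<omega> \<in> A \<and> (W \<omega>, V \<omega>) \<in> D} \<omega> \<partial>M)"
      by (rule nn_integral_indicator[symmetric]) measurable
    also have "\<dots> = (\<integral>\<^sup>+\<omega>. (\<lambda>x. indicator A (fst x) * indicator D (snd (snd x), fst (snd x))) (U \<omega>, (V \<omega>, W \<omega>)) \<partial>M)"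
      by (intro nn_integral_cong) (auto split: split_indicator)
    also have "\<dots> = (\<integral>\<^sup>+x. F x * (indicator A (fst x) * indicator D (snd (snd x), fst (snd x))) \<partial>(S \<Otimes>\<^sub>M (T \<Otimes>\<^sub>M R)))"
      by (rule distributed_nn_integral[OF d, symmetric]) measurable
    also have "\<dots> = (\<integral>\<^sup>+u. (\<integral>\<^sup>+x. F (u, x) * indicator D (snd x, fst x) \<partial>(T \<Otimes>\<^sub>M R)) * indicator A u \<partial>S)"
      by (subst sigma_finite_measure.nn_integral_fst[OF TR, symmetric], measurable, intro nn_integral_cong,
          subst nn_integral_multc[symmetric]) (auto simp: ac_simps)
    also have "\<dots> = (\<integral>\<^sup>+u. (\<integral>\<^sup>+x. (case (u, x) of (u, (z, v)) \<Rightarrow> F (u, (v, z))) * indicator D x \<partial>(R \<Otimes>\<^sub>M T)) * indicator A u \<partial>S)"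
    proof (intro nn_integral_cong arg_cong2[where f="(*)"] refl)
      fix u assume [measurable]: "u \<in> space S"
      show "(\<integral>\<^sup>+x. F (u, x) * indicator D (snd x, fst x) \<partial>(T \<Otimes>\<^sub>M R))
        = (\<integral>\<^sup>+x. (case (u, x) of (u, (z, v)) \<Rightarrow> F (u, (v, z))) * indicator D x \<partial>(R \<Otimes>\<^sub>M T))"
        by (subst RT.distr_pair_swap, subst nn_integral_distr) (auto simp: split_beta')
    qed
    finally show "emeasure M {\<omega> \<in> space M. U \<omega> \<in> A \<and> (W \<omega>, V \<omega>) \<in> D} = \<dots>" .
  qed auto
qed

section \<open>Entropies and expectations of log densities\<close>

lemma nn_integral_distributed_eq_1:
  assumes "distributed M S V d"
  shows "(\<integral>\<^sup>+x. d x \<partial>S) = 1"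
  using distributed_nn_integral[OF assms, of "\<lambda>_. 1"] by (simp add: emeasure_space_1)

text \<open>In this form all entropies become integrals over the single space \<open>M\<close>,
  where log densities along different variables can be added and compared pointwise.\<close>

lemma entropy_eq_expectation:
  fixes f :: "'b \<Rightarrow> real"
  assumes d: "distributed M S V (\<lambda>x. ennreal (f x))" and f0: "\<And>x. 0 \<le> f x"
  shows "entropy (exp 1) S V = - (\<integral>\<omega>. ln (f (V \<omega>)) \<partial>M)"
proof -
  interpret information_space M "exp 1" by unfold_locales simp
  have [measurable]: "f \<in> borel_measurable S"
    using assms by (intro distributed_real_measurable) auto
  show ?thesis
    using entropy_distr[OF d f0] distributed_integral[OF d, of "\<lambda>x. ln (f x)"] f0
    by (simp add: log_def)
qed

lemma conditional_entropy_eq_expectation: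
  fixes f :: "'b \<times> 'c \<Rightarrow> real" and w :: "'c \<Rightarrow> real"
  assumes S: "sigma_finite_measure S" and T: "sigma_finite_measure T"
    and d: "distributed M (S \<Otimes>\<^sub>M T) (\<lambda>\<omega>. (V \<omega>, W \<omega>)) (\<lambda>x. ennreal (f x))" and f0: "\<And>x. 0 \<le> f x"
    and W: "distributed M T W (\<lambda>x. ennreal (w x))" and w0: "\<And>x. 0 \<le> w x"
  shows "conditional_entropy (exp 1) S T V W = - (\<integral>\<omega>. ln (f (V \<omega>, W \<omega>) / w (W \<omega>)) \<partial>M)"
proof -
  interpret information_space M "exp 1" by unfold_locales simp
  have [measurable]: "f \<in> borel_measurable (S \<Otimes>\<^sub>M T)" "w \<in> borel_measurable T"
    using assms by (auto intro: distributed_real_measurable)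
  show ?thesis
    using conditional_entropy_generic_eq[OF S T W w0 d f0]
      distributed_integral[OF d, of "\<lambda>x. ln (f x / w (snd x))"] f0
    by (simp add: log_def split_beta')
qed

lemma has_finite_dentropyE:
  assumes "has_finite_dentropy M S V" "space S = UNIV"
  obtains f :: "'b \<Rightarrow> real" where "distributed M S V (\<lambda>x. ennreal (f x))" "\<And>x. 0 \<le> f x"
    "f \<in> borel_measurable S" "integrable M (\<lambda>\<omega>. ln (f (V \<omega>)))"
proof -
  from assms obtain f where d: "distributed M S V (\<lambda>x. ennreal (f x))" and f0: "\<And>x. 0 \<le> f x"
    and i: "integrable S (\<lambda>x. f x * ln (f x))"
    unfolding has_finite_dentropy_def by auto
  have [measurable]: "f \<in> borel_measurable S"
    using d f0 by (intro distributed_real_measurable) auto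
  have "integrable M (\<lambda>\<omega>. ln (f (V \<omega>)))"
    using distributed_integrable[OF d, of "\<lambda>x. ln (f x)"] f0 i by simp
  then show ?thesis
    using that d f0 by simp
qed

text \<open>\<open>F * (G / F)\<close> is at most \<open>G\<close>, with equality except at zeros of
  \<open>F\<close>, where the quotient is 0. Combined with \<open>ln u \<le> u - 1\<close>, this is
  how Gibbs' inequality enters.\<close>

lemma expectation_density_ratio_le_1:
  fixes F G :: "'b \<Rightarrow> real"
  assumes d: "distributed M S V (\<lambda>x. ennreal (F x))" and F0: "\<And>x. 0 \<le> F x"
    and [measurable]: "G \<in> borel_measurable S" and G0: "\<And>x. 0 \<le> G x"
    and G1: "(\<integral>\<^sup>+x. ennreal (G x) \<partial>S) \<le> 1"
  shows "integrable M (\<lambda>\<omega>. G (V \<omega>) / F (V \<omega>))" "(\<integral>\<omega>. G (V \<omega>) / F (V \<omega>) \<partial>M) \<le> 1"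
proof -
  have [measurable]: "F \<in> borel_measurable S" and [measurable]: "V \<in> measurable M S"
    using d F0 by (auto intro: distributed_real_measurable distributed_measurable)
  have "(\<integral>\<^sup>+\<omega>. ennreal (G (V \<omega>) / F (V \<omega>)) \<partial>M) = (\<integral>\<^sup>+x. ennreal (F x) * ennreal (G x / F x) \<partial>S)"
    by (subst distributed_nn_integral[OF d]) auto
  also have "\<dots> \<le> (\<integral>\<^sup>+x. ennreal (G x) \<partial>S)"
    using F0 G0 by (intro nn_integral_mono) (auto simp: ennreal_mult[symmetric])
  finally have le: "(\<integral>\<^sup>+\<omega>. ennreal (G (V \<omega>) / F (V \<omega>)) \<partial>M) \<le> 1"
    using G1 by simp
  show i: "integrable M (\<lambda>\<omega>. G (V \<omega>) / F (V \<omega>))"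
    using le F0 G0 by (intro integrableI_nonneg) (auto simp: le_less_trans)
  show "(\<integral>\<omega>. G (V \<omega>) / F (V \<omega>) \<partial>M) \<le> 1"
    using le nn_integral_eq_integral[OF i] F0 G0 by simp
qed

end

section \<open>The three conditional entropy bounds along the Markov chain\<close>

theorem mainTheorem14:
  fixes M :: "'a measure"
    and X Y X\<^sub>1 X\<^sub>2 Ym Y' :: "'a \<Rightarrow> real"
    and K :: real
  assumes M: "prob_space M"
    and K: "K \<ge> 1"
    (* standing conventions: densities exist, entropies exist and are finite *)
    and dX: "has_finite_dentropy M lborel X"
    and dY: "has_finite_dentropy M lborel Y"
    and dXY: "has_finite_dentropy M (lborel \<Otimes>\<^sub>M lborel) (\<lambda>\<omega>. (X \<omega>, Y \<omega>))"
    and dXpY: "has_finite_dentropy M lborel (\<lambda>\<omega>. X \<omega> + Y \<omega>)"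
    and d4: "has_density M (lborel \<Otimes>\<^sub>M (lborel \<Otimes>\<^sub>M (lborel \<Otimes>\<^sub>M lborel)))
               (\<lambda>\<omega>. (X\<^sub>2 \<omega>, Ym \<omega>, X\<^sub>1 \<omega>, Y' \<omega>))"
    and dX1Y: "has_finite_dentropy M (lborel \<Otimes>\<^sub>M lborel) (\<lambda>\<omega>. (X\<^sub>1 \<omega>, Ym \<omega>))"
    and dX2X1Y: "has_finite_dentropy M (lborel \<Otimes>\<^sub>M (lborel \<Otimes>\<^sub>M lborel))
               (\<lambda>\<omega>. (X\<^sub>2 \<omega>, (X\<^sub>1 \<omega>, Ym \<omega>)))"
    and dY'X1Y: "has_finite_dentropy M (lborel \<Otimes>\<^sub>M (lborel \<Otimes>\<^sub>M lborel))
               (\<lambda>\<omega>. (Y' \<omega>, (X\<^sub>1 \<omega>, Ym \<omega>)))"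
    and dSX1Y: "has_finite_dentropy M (lborel \<Otimes>\<^sub>M (lborel \<Otimes>\<^sub>M lborel))
               (\<lambda>\<omega>. (X\<^sub>2 \<omega> + Y' \<omega>, (X\<^sub>1 \<omega>, Ym \<omega>)))"
    (* I(X;Y) \<le> log K and the sumset-type bound *)
    and hI: "dent M (lborel \<Otimes>\<^sub>M lborel) (\<lambda>\<omega>. (X \<omega>, Y \<omega>))
               \<ge> dent M lborel X + dent M lborel Y - ln K"
    and hS: "dent M lborel (\<lambda>\<omega>. X \<omega> + Y \<omega>)
               \<le> dent M lborel X / 2 + dent M lborel Y / 2 + ln K"
    (* Markov chain X2 - Y - X1 - Y' *)
    and mc1: "cond_indep M lborel X\<^sub>1 lborel X\<^sub>2 lborel Ym"
    and mc2: "cond_indep M lborel Y' (lborel \<Otimes>\<^sub>M lborel) (\<lambda>\<omega>. (X\<^sub>2 \<omega>, Ym \<omega>)) lborel X\<^sub>1"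
    (* the three pairs are distributed like (X,Y) *)
    and e1: "distr M (lborel \<Otimes>\<^sub>M lborel) (\<lambda>\<omega>. (X\<^sub>2 \<omega>, Ym \<omega>))
               = distr M (lborel \<Otimes>\<^sub>M lborel) (\<lambda>\<omega>. (X \<omega>, Y \<omega>))"
    and e2: "distr M (lborel \<Otimes>\<^sub>M lborel) (\<lambda>\<omega>. (X\<^sub>1 \<omega>, Ym \<omega>))
               = distr M (lborel \<Otimes>\<^sub>M lborel) (\<lambda>\<omega>. (X \<omega>, Y \<omega>))"
    and e3: "distr M (lborel \<Otimes>\<^sub>M lborel) (\<lambda>\<omega>. (X\<^sub>1 \<omega>, Y' \<omega>))
               = distr M (lborel \<Otimes>\<^sub>M lborel) (\<lambda>\<omega>. (X \<omega>, Y \<omega>))"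
  shows "(cdent M lborel (lborel \<Otimes>\<^sub>M lborel) X\<^sub>2 (\<lambda>\<omega>. (X\<^sub>1 \<omega>, Ym \<omega>))
           \<ge> dent M lborel X - ln K) \<and>
         (cdent M lborel (lborel \<Otimes>\<^sub>M lborel) Y' (\<lambda>\<omega>. (X\<^sub>1 \<omega>, Ym \<omega>))
           \<ge> dent M lborel Y - ln K) \<and>
         (cdent M lborel (lborel \<Otimes>\<^sub>M lborel) (\<lambda>\<omega>. X\<^sub>2 \<omega> + Y' \<omega>) (\<lambda>\<omega>. (X\<^sub>1 \<omega>, Ym \<omega>))
           \<le> dent M lborel X / 2 + dent M lborel Y / 2 + 7 * ln K)"
proof -
  interpret prob_space M by (rule M)
  let ?L = "lborel :: real measure"
  have sf: "sigma_finite_measure ?L"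
    by (rule lborel.sigma_finite_measure_axioms)
  have sf2: "sigma_finite_measure (?L \<Otimes>\<^sub>M ?L)"
    by (subst lborel_prod) (rule lborel.sigma_finite_measure_axioms)

  \<comment> \<open>Densities of the variables, pairs and sums\<close>
  obtain a where a: "distributed M ?L X (\<lambda>x. ennreal (a x))" and a0: "\<And>x. 0 \<le> a x"
    and a_meas: "a \<in> borel_measurable ?L" and a_int: "integrable M (\<lambda>\<omega>. ln (a (X \<omega>)))"
    using has_finite_dentropyE[OF dX] by auto
  obtain b where b: "distributed M ?L Y (\<lambda>x. ennreal (b x))" and b0: "\<And>x. 0 \<le> b x"
    and b_meas: "b \<in> borel_measurable ?L" and b_int: "integrable M (\<lambda>\<omega>. ln (b (Y \<omega>)))"
    using has_finite_dentropyE[OF dY] by auto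
  obtain g where g: "distributed M ?L (\<lambda>\<omega>. X \<omega> + Y \<omega>) (\<lambda>x. ennreal (g x))" and g0: "\<And>x. 0 \<le> g x"
    and g_meas: "g \<in> borel_measurable ?L" and g_int: "integrable M (\<lambda>\<omega>. ln (g (X \<omega> + Y \<omega>)))"
    using has_finite_dentropyE[OF dXpY] by auto
  obtain f where f: "distributed M (?L \<Otimes>\<^sub>M ?L) (\<lambda>\<omega>. (X \<omega>, Y \<omega>)) (\<lambda>x. ennreal (f x))"
    and f0: "\<And>x. 0 \<le> f x" and f_meas [measurable]: "f \<in> borel_measurable (?L \<Otimes>\<^sub>M ?L)"
    and f_int: "integrable M (\<lambda>\<omega>. ln (f (X \<omega>, Y \<omega>)))"
    using has_finite_dentropyE[OF dXY] by (auto simp: space_pair_measure)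
  obtain k where k: "distributed M (?L \<Otimes>\<^sub>M (?L \<Otimes>\<^sub>M ?L)) (\<lambda>\<omega>. (X\<^sub>2 \<omega> + Y' \<omega>, (X\<^sub>1 \<omega>, Ym \<omega>))) (\<lambda>x. ennreal (k x))"
    and k0: "\<And>x. 0 \<le> k x" and k_meas [measurable]: "k \<in> borel_measurable (?L \<Otimes>\<^sub>M (?L \<Otimes>\<^sub>M ?L))"
    and k_int: "integrable M (\<lambda>\<omega>. ln (k (X\<^sub>2 \<omega> + Y' \<omega>, (X\<^sub>1 \<omega>, Ym \<omega>))))"
    using has_finite_dentropyE[OF dSX1Y] by (auto simp: space_pair_measure)
  have [measurable]: "a \<in> borel_measurable borel" "b \<in> borel_measurable borel" "g \<in> borel_measurable borel"
    using a_meas b_meas g_meas by auto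

  have "(\<lambda>\<omega>. (X\<^sub>2 \<omega>, Ym \<omega>, X\<^sub>1 \<omega>, Y' \<omega>)) \<in> measurable M (?L \<Otimes>\<^sub>M (?L \<Otimes>\<^sub>M (?L \<Otimes>\<^sub>M ?L)))"
    using d4 by (auto simp: has_density_def dest: distributed_measurable)
  from measurable_compose[OF this measurable_fst]
    measurable_compose[OF measurable_compose[OF this measurable_snd] measurable_fst]
    measurable_compose[OF measurable_compose[OF measurable_compose[OF this measurable_snd] measurable_snd] measurable_fst]
    measurable_compose[OF measurable_compose[OF measurable_compose[OF this measurable_snd] measurable_snd] measurable_snd]
  have [measurable]: "X\<^sub>2 \<in> borel_measurable M" "Ym \<in> borel_measurable M"
    "X\<^sub>1 \<in> borel_measurable M" "Y' \<in> borel_measurable M"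
    by simp_all
  have [measurable]: "X \<in> borel_measurable M" "Y \<in> borel_measurable M"
    using a b by (auto dest: distributed_measurable)

  have f2: "distributed M (?L \<Otimes>\<^sub>M ?L) (\<lambda>\<omega>. (X\<^sub>2 \<omega>, Ym \<omega>)) (\<lambda>x. ennreal (f x))"
    by (rule distributed_transform_distr_eq[OF e1 _ _ measurable_ident_sets[OF refl] f]) measurable
  have f1: "distributed M (?L \<Otimes>\<^sub>M ?L) (\<lambda>\<omega>. (X\<^sub>1 \<omega>, Ym \<omega>)) (\<lambda>x. ennreal (f x))"
    by (rule distributed_transform_distr_eq[OF e2 _ _ measurable_ident_sets[OF refl] f]) measurable
  have f3: "distributed M (?L \<Otimes>\<^sub>M ?L) (\<lambda>\<omega>. (X\<^sub>1 \<omega>, Y' \<omega>)) (\<lambda>x. ennreal (f x))"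
    by (rule distributed_transform_distr_eq[OF e3 _ _ measurable_ident_sets[OF refl] f]) measurable
  have a2: "distributed M ?L X\<^sub>2 (\<lambda>x. ennreal (a x))"
    using distributed_transform_distr_eq[OF e1 _ _ measurable_fst] a by simp
  have a1: "distributed M ?L X\<^sub>1 (\<lambda>x. ennreal (a x))"
    using distributed_transform_distr_eq[OF e2 _ _ measurable_fst] a by simp
  have bm: "distributed M ?L Ym (\<lambda>x. ennreal (b x))"
    using distributed_transform_distr_eq[OF e2 _ _ measurable_snd] b by simp
  have b': "distributed M ?L Y' (\<lambda>x. ennreal (b x))"
    using distributed_transform_distr_eq[OF e3 _ _ measurable_snd] b by simp
  \<comment> \<open>The law of a sum depends only on the joint law, so the sums of the three pairs
    inherit the density \<open>g\<close>. The fourth sum, of \<open>X\<^sub>2\<close> and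
    \<open>Y'\<close>, is not covered, as that pair need not be distributed like
    \<open>(X, Y)\<close>.\<close>
  have plus: "(\<lambda>x. fst x + snd x) \<in> measurable (?L \<Otimes>\<^sub>M ?L) ?L"
    by measurable
  have gp: "distributed M ?L (\<lambda>\<omega>. X\<^sub>2 \<omega> + Ym \<omega>) (\<lambda>x. ennreal (g x))"
    using distributed_transform_distr_eq[OF e1 _ _ plus] g by simp
  have gq: "distributed M ?L (\<lambda>\<omega>. X\<^sub>1 \<omega> + Ym \<omega>) (\<lambda>x. ennreal (g x))"
    using distributed_transform_distr_eq[OF e2 _ _ plus] g by simp
  have gr: "distributed M ?L (\<lambda>\<omega>. X\<^sub>1 \<omega> + Y' \<omega>) (\<lambda>x. ennreal (g x))"
    using distributed_transform_distr_eq[OF e3 _ _ plus] g by simp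

  have ln_f: "(\<lambda>x. ln (f x)) \<in> borel_measurable (?L \<Otimes>\<^sub>M ?L)" by measurable
  have ln_a: "(\<lambda>x. ln (a x)) \<in> borel_measurable ?L" and ln_b: "(\<lambda>x. ln (b x)) \<in> borel_measurable ?L"
    and ln_g: "(\<lambda>x. ln (g x)) \<in> borel_measurable ?L" by measurable
  \<comment> \<open>Simplification now turns each expectation of a log density of a variable, pair
    or sum of the chain into the corresponding one for \<open>X\<close>, \<open>Y\<close>,
    \<open>(X, Y)\<close> or \<open>X + Y\<close>.\<close>
  note [simp] = integral_distributed_eq[OF f2 f f0 ln_f] integral_distributed_eq[OF f1 f f0 ln_f]
    integral_distributed_eq[OF f3 f f0 ln_f]
    integral_distributed_eq[OF a2 a a0 ln_a] integral_distributed_eq[OF a1 a a0 ln_a]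
    integral_distributed_eq[OF bm b b0 ln_b] integral_distributed_eq[OF b' b b0 ln_b]
    integral_distributed_eq[OF gp g g0 ln_g] integral_distributed_eq[OF gq g g0 ln_g]
    integral_distributed_eq[OF gr g g0 ln_g]
  have [simp]: "integrable M (\<lambda>\<omega>. ln (f (X\<^sub>2 \<omega>, Ym \<omega>)))" "integrable M (\<lambda>\<omega>. ln (f (X\<^sub>1 \<omega>, Ym \<omega>)))"
    "integrable M (\<lambda>\<omega>. ln (f (X\<^sub>1 \<omega>, Y' \<omega>)))"
    using integrable_distributed_eq[OF f2 f f0 ln_f] integrable_distributed_eq[OF f1 f f0 ln_f]
      integrable_distributed_eq[OF f3 f f0 ln_f] f_int by simp_all
  have [simp]: "integrable M (\<lambda>\<omega>. ln (a (X\<^sub>2 \<omega>)))" "integrable M (\<lambda>\<omega>. ln (a (X\<^sub>1 \<omega>)))"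
    "integrable M (\<lambda>\<omega>. ln (b (Ym \<omega>)))" "integrable M (\<lambda>\<omega>. ln (b (Y' \<omega>)))"
    using integrable_distributed_eq[OF a2 a a0 ln_a] integrable_distributed_eq[OF a1 a a0 ln_a] a_int
      integrable_distributed_eq[OF bm b b0 ln_b] integrable_distributed_eq[OF b' b b0 ln_b] b_int by simp_all
  have [simp]: "integrable M (\<lambda>\<omega>. ln (g (X\<^sub>2 \<omega> + Ym \<omega>)))" "integrable M (\<lambda>\<omega>. ln (g (X\<^sub>1 \<omega> + Ym \<omega>)))"
    "integrable M (\<lambda>\<omega>. ln (g (X\<^sub>1 \<omega> + Y' \<omega>)))"
    using integrable_distributed_eq[OF gp g g0 ln_g] integrable_distributed_eq[OF gq g g0 ln_g]
      integrable_distributed_eq[OF gr g g0 ln_g] g_int by simp_all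
  note k_int [simp]
  note pos = distributed_AE_pos[OF f2 f0] distributed_AE_pos[OF f1 f0] distributed_AE_pos[OF f3 f0]
    distributed_AE_pos[OF a2 a0] distributed_AE_pos[OF a1 a0]
    distributed_AE_pos[OF bm b0] distributed_AE_pos[OF b' b0]
    distributed_AE_pos[OF gp g0] distributed_AE_pos[OF gq g0] distributed_AE_pos[OF gr g0]
    distributed_AE_pos[OF k k0]
  note h = entropy_eq_expectation[OF a a0] entropy_eq_expectation[OF b b0]
    entropy_eq_expectation[OF g g0] entropy_eq_expectation[OF f f0]

  \<comment> \<open>The two lower bounds, from the Markov property\<close>
  have c1: "cdent M lborel (lborel \<Otimes>\<^sub>M lborel) X\<^sub>2 (\<lambda>\<omega>. (X\<^sub>1 \<omega>, Ym \<omega>))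
      = dent M (lborel \<Otimes>\<^sub>M lborel) (\<lambda>\<omega>. (X \<omega>, Y \<omega>)) - dent M lborel Y"
  proof -
    \<comment> \<open>\<open>X\<^sub>2\<close> and \<open>X\<^sub>1\<close> are conditionally
      independent given \<open>Ym\<close>, whence this density. Dividing by the density
      \<open>f (v, z)\<close> of \<open>(X\<^sub>1, Ym)\<close> leaves
      \<open>f (u, z) / b z\<close>, which is free of \<open>v\<close>.\<close>
    let ?d = "\<lambda>(u, (v, z)). f (u, z) * f (v, z) / b z"
    have "distributed M (?L \<Otimes>\<^sub>M (?L \<Otimes>\<^sub>M ?L)) (\<lambda>\<omega>. (X\<^sub>2 \<omega>, (X\<^sub>1 \<omega>, Ym \<omega>))) (\<lambda>x. ennreal (?d x))"
      using distributed_cond_indep[OF sf sf sf cond_indep_sym[OF mc1] f2 f0 f1 f0 bm b0]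
      by (simp add: split_beta')
    then have "cdent M lborel (lborel \<Otimes>\<^sub>M lborel) X\<^sub>2 (\<lambda>\<omega>. (X\<^sub>1 \<omega>, Ym \<omega>))
      = - (\<integral>\<omega>. ln (?d (X\<^sub>2 \<omega>, (X\<^sub>1 \<omega>, Ym \<omega>)) / f (X\<^sub>1 \<omega>, Ym \<omega>)) \<partial>M)"
      by (rule conditional_entropy_eq_expectation[OF sf sf2 _ _ f1 f0]) (auto simp: f0 b0)
    also have "(\<integral>\<omega>. ln (?d (X\<^sub>2 \<omega>, (X\<^sub>1 \<omega>, Ym \<omega>)) / f (X\<^sub>1 \<omega>, Ym \<omega>)) \<partial>M)
      = (\<integral>\<omega>. ln (f (X\<^sub>2 \<omega>, Ym \<omega>)) - ln (b (Ym \<omega>)) \<partial>M)"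
    proof (rule integral_cong_AE)
      show "AE \<omega> in M. ln (?d (X\<^sub>2 \<omega>, (X\<^sub>1 \<omega>, Ym \<omega>)) / f (X\<^sub>1 \<omega>, Ym \<omega>))
          = ln (f (X\<^sub>2 \<omega>, Ym \<omega>)) - ln (b (Ym \<omega>))"
        using pos by eventually_elim (simp add: ln_div ln_mult)
    qed measurable
    finally show ?thesis
      by (simp add: h)
  qed

  have c2: "cdent M lborel (lborel \<Otimes>\<^sub>M lborel) Y' (\<lambda>\<omega>. (X\<^sub>1 \<omega>, Ym \<omega>))
      = dent M (lborel \<Otimes>\<^sub>M lborel) (\<lambda>\<omega>. (X \<omega>, Y \<omega>)) - dent M lborel X"
  proof -
    \<comment> \<open>The conditioning variable is now \<open>X\<^sub>1\<close>, in the middle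
      coordinate \<open>v\<close>; dividing by \<open>f (v, z)\<close> leaves
      \<open>f (v, u) / a v\<close>.\<close>
    let ?d = "\<lambda>(u, (v, z)). f (v, u) * f (v, z) / a v"
    have ci: "cond_indep M ?L Y' ?L Ym ?L X\<^sub>1"
      by (rule cond_indep_snd[OF mc2]) auto
    have "distributed M (?L \<Otimes>\<^sub>M ?L) (\<lambda>\<omega>. (Y' \<omega>, X\<^sub>1 \<omega>)) (\<lambda>x. ennreal (f (snd x, fst x)))"
      "distributed M (?L \<Otimes>\<^sub>M ?L) (\<lambda>\<omega>. (Ym \<omega>, X\<^sub>1 \<omega>)) (\<lambda>x. ennreal (f (snd x, fst x)))"
      using distributed_swap[OF sf sf f3] distributed_swap[OF sf sf f1] by (simp_all add: split_beta')
    from distributed_swap_snd[OF sf sf sf distributed_cond_indep[OF sf sf sf ci this(1) f0 this(2) f0 a1 a0]]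
    have "distributed M (?L \<Otimes>\<^sub>M (?L \<Otimes>\<^sub>M ?L)) (\<lambda>\<omega>. (Y' \<omega>, (X\<^sub>1 \<omega>, Ym \<omega>))) (\<lambda>x. ennreal (?d x))"
      by (simp add: split_beta')
    then have "cdent M lborel (lborel \<Otimes>\<^sub>M lborel) Y' (\<lambda>\<omega>. (X\<^sub>1 \<omega>, Ym \<omega>))
      = - (\<integral>\<omega>. ln (?d (Y' \<omega>, (X\<^sub>1 \<omega>, Ym \<omega>)) / f (X\<^sub>1 \<omega>, Ym \<omega>)) \<partial>M)"
      by (rule conditional_entropy_eq_expectation[OF sf sf2 _ _ f1 f0]) (auto simp: f0 a0)
    also have "(\<integral>\<omega>. ln (?d (Y' \<omega>, (X\<^sub>1 \<omega>, Ym \<omega>)) / f (X\<^sub>1 \<omega>, Ym \<omega>)) \<partial>M)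
      = (\<integral>\<omega>. ln (f (X\<^sub>1 \<omega>, Y' \<omega>)) - ln (a (X\<^sub>1 \<omega>)) \<partial>M)"
    proof (rule integral_cong_AE)
      show "AE \<omega> in M. ln (?d (Y' \<omega>, (X\<^sub>1 \<omega>, Ym \<omega>)) / f (X\<^sub>1 \<omega>, Ym \<omega>))
          = ln (f (X\<^sub>1 \<omega>, Y' \<omega>)) - ln (a (X\<^sub>1 \<omega>))"
        using pos by eventually_elim (simp add: ln_div ln_mult)
    qed measurable
    finally show ?thesis
      by (simp add: h)
  qed

  \<comment> \<open>The density of the chain and the convolution along it\<close>
  let ?F = "\<lambda>(y', ((x2, y), x1)). f (x1, y') * (f (x1, y) * f (x2, y) / b y) / a x1"
  \<comment> \<open>Conditional independence is applied twice: at \<open>Ym\<close>, then at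
    \<open>X\<^sub>1\<close> with the pair \<open>(X\<^sub>2, Ym)\<close> as one variable. The order
    of coordinates follows \<open>mc2\<close>.\<close>
  have F: "distributed M (?L \<Otimes>\<^sub>M ((?L \<Otimes>\<^sub>M ?L) \<Otimes>\<^sub>M ?L)) (\<lambda>\<omega>. (Y' \<omega>, ((X\<^sub>2 \<omega>, Ym \<omega>), X\<^sub>1 \<omega>)))
    (\<lambda>x. ennreal (?F x))"
  proof -
    let ?d = "\<lambda>((x2, y), x1). f (x1, y) * f (x2, y) / b y"
    have 1: "distributed M ((?L \<Otimes>\<^sub>M ?L) \<Otimes>\<^sub>M ?L) (\<lambda>\<omega>. ((X\<^sub>2 \<omega>, Ym \<omega>), X\<^sub>1 \<omega>)) (\<lambda>x. ennreal (?d x))"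
      using distributed_swap[OF sf sf2 distributed_cond_indep[OF sf sf sf mc1 f1 f0 f2 f0 bm b0]]
      by (simp add: split_beta')
    have 2: "distributed M (?L \<Otimes>\<^sub>M ?L) (\<lambda>\<omega>. (Y' \<omega>, X\<^sub>1 \<omega>)) (\<lambda>x. ennreal (f (snd x, fst x)))"
      using distributed_swap[OF sf sf f3] by (simp add: split_beta')
    have 3: "0 \<le> ?d x" for x
      by (auto simp: f0 b0 split_beta')
    show ?thesis
      using distributed_cond_indep[OF sf sf2 sf mc2 2 f0 1 3 a1 a0] by (simp add: split_beta')
  qed
  have F0: "0 \<le> ?F x" for x
    by (auto simp: f0 b0 a0 split_beta')

  let ?a = "\<lambda>x. ennreal (a x)" and ?b = "\<lambda>x. ennreal (b x)"
  let ?c = "nn_conv ?a ?b"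
  let ?r = "\<lambda>s. enn2real (?c s)"
  have c_1: "(\<integral>\<^sup>+s. ?c s \<partial>lborel) = 1"
    by (rule nn_integral_nn_conv_1[OF _ _ nn_integral_distributed_eq_1[OF a] nn_integral_distributed_eq_1[OF b]]) measurable
  \<comment> \<open>\<open>X\<^sub>2\<close> and \<open>Y'\<close> need not be independent, so
    \<open>?c\<close> need not be the density of their sum. Positivity comes instead from absolute
    continuity of the joint law of the four variables.\<close>
  have c_pos: "AE \<omega> in M. 0 < ?c (X\<^sub>2 \<omega> + Y' \<omega>)"
  proof -
    have "AE x in ?L \<Otimes>\<^sub>M ((?L \<Otimes>\<^sub>M ?L) \<Otimes>\<^sub>M ?L). 0 < ?a (fst (fst (snd x))) \<longrightarrow> 0 < ?b (fst x) \<longrightarrow>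
        0 < ?c (fst (fst (snd x)) + fst x)"
      by (rule AE_nn_conv_pos_path) measurable
    then have "AE \<omega> in M. 0 < ?a (X\<^sub>2 \<omega>) \<longrightarrow> 0 < ?b (Y' \<omega>) \<longrightarrow> 0 < ?c (X\<^sub>2 \<omega> + Y' \<omega>)"
      using distributed_AE2[OF F, of "\<lambda>x. 0 < ?a (fst (fst (snd x))) \<longrightarrow> 0 < ?b (fst x) \<longrightarrow>
        0 < ?c (fst (fst (snd x)) + fst x)"] by (auto elim!: eventually_mono)
    then show ?thesis
      using pos(4,7) by eventually_elim simp
  qed
  \<comment> \<open>\<open>?c\<close> has total mass 1, so it is finite off a Lebesgue null set. The
    law of the sum ignores null sets because it has a density, a marginal of
    \<open>k\<close>.\<close>
  have c_fin: "AE \<omega> in M. ?c (X\<^sub>2 \<omega> + Y' \<omega>) < \<infinity>"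
  proof -
    have "AE s in ?L. ?c s \<noteq> \<infinity>"
      by (rule nn_integral_PInf_AE) (auto simp: c_1)
    then have "AE s in ?L. 0 < (\<integral>\<^sup>+z. ennreal (k (s, z)) \<partial>(?L \<Otimes>\<^sub>M ?L)) \<longrightarrow> ?c s < \<infinity>"
      by eventually_elim (simp add: less_top)
    then show ?thesis
      by (subst distributed_AE2[OF distr_marginal1[OF sf sf2 k]]) auto
  qed
  have r_pos: "AE \<omega> in M. 0 < ?r (X\<^sub>2 \<omega> + Y' \<omega>)"
    using c_pos c_fin by eventually_elim (simp add: enn2real_positive_iff)

  \<comment> \<open>Two density ratios of mean at most 1\<close>
  let ?G1 = "\<lambda>x. g (fst (fst (snd x)) + snd (fst (snd x))) * g (snd (snd x) + snd (fst (snd x))) *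
    g (snd (snd x) + fst x) * a (fst (fst (snd x))) * b (fst x) / ?r (fst (fst (snd x)) + fst x)"
  let ?u1 = "\<lambda>\<omega>. ?G1 (Y' \<omega>, ((X\<^sub>2 \<omega>, Ym \<omega>), X\<^sub>1 \<omega>)) / ?F (Y' \<omega>, ((X\<^sub>2 \<omega>, Ym \<omega>), X\<^sub>1 \<omega>))"
  have G1: "(\<integral>\<^sup>+x. ennreal (?G1 x) \<partial>(?L \<Otimes>\<^sub>M ((?L \<Otimes>\<^sub>M ?L) \<Otimes>\<^sub>M ?L))) \<le> 1"
  proof -
    have "(\<integral>\<^sup>+x. ennreal (?G1 x) \<partial>(?L \<Otimes>\<^sub>M ((?L \<Otimes>\<^sub>M ?L) \<Otimes>\<^sub>M ?L)))
      = (\<integral>\<^sup>+y'. \<integral>\<^sup>+x2. \<integral>\<^sup>+y. \<integral>\<^sup>+x1. ennreal (?G1 (y', ((x2, y), x1))) \<partial>?L \<partial>?L \<partial>?L \<partial>?L)"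
      by (rule nn_integral_lborel_prod4) measurable
    also have "\<dots> = (\<integral>\<^sup>+y'. \<integral>\<^sup>+x2. \<integral>\<^sup>+y. \<integral>\<^sup>+x1. ?a x2 * ?b y' * ennreal (1 / ?r (x2 + y')) *
      (ennreal (g (x2 + y)) * (ennreal (g (x1 + y)) * ennreal (g (x1 + y')))) \<partial>?L \<partial>?L \<partial>?L \<partial>?L)"
      by (intro nn_integral_cong) (simp add: ennreal_mult[symmetric] a0 b0 g0 ac_simps)
    also have "\<dots> \<le> 1"
      by (rule nn_integral_path_le_1[OF _ _ _ nn_integral_distributed_eq_1[OF g]]) measurable
    finally show ?thesis .
  qed
  have u1: "integrable M ?u1" "(\<integral>\<omega>. ?u1 \<omega> \<partial>M) \<le> 1"
  proof -
    have *: "?G1 \<in> borel_measurable (?L \<Otimes>\<^sub>M ((?L \<Otimes>\<^sub>M ?L) \<Otimes>\<^sub>M ?L))" by measurable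
    have **: "0 \<le> ?G1 x" for x by (auto simp: g0 a0 b0 split_beta')
    show "integrable M ?u1" "(\<integral>\<omega>. ?u1 \<omega> \<partial>M) \<le> 1"
      by (rule expectation_density_ratio_le_1[OF F F0 * ** G1])+
  qed

  \<comment> \<open>A competitor to \<open>k\<close> that makes the sum independent of
    \<open>(X\<^sub>1, Ym)\<close>. Its factor \<open>?r\<close> is chosen to cancel the one in
    \<open>?G1\<close>, its factor \<open>f\<close> to cancel one of the three in
    \<open>?F\<close>.\<close>
  let ?G2 = "\<lambda>x. ?r (fst x) * f (snd x)"
  let ?u2 = "\<lambda>\<omega>. ?G2 (X\<^sub>2 \<omega> + Y' \<omega>, (X\<^sub>1 \<omega>, Ym \<omega>)) / k (X\<^sub>2 \<omega> + Y' \<omega>, (X\<^sub>1 \<omega>, Ym \<omega>))"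
  have G2: "(\<integral>\<^sup>+x. ennreal (?G2 x) \<partial>(?L \<Otimes>\<^sub>M (?L \<Otimes>\<^sub>M ?L))) \<le> 1"
  proof -
    have "(\<integral>\<^sup>+x. ennreal (?G2 x) \<partial>(?L \<Otimes>\<^sub>M (?L \<Otimes>\<^sub>M ?L)))
      \<le> (\<integral>\<^sup>+x. ?c (fst x) * ennreal (f (snd x)) \<partial>(?L \<Otimes>\<^sub>M (?L \<Otimes>\<^sub>M ?L)))"
    proof (rule nn_integral_mono)
      fix x :: "real \<times> real \<times> real"
      \<comment> \<open>\<open>enn2real\<close> sends infinity to 0, so passing to \<open>?r\<close>
        can only decrease the value.\<close>
      have "ennreal (?r (fst x)) \<le> ?c (fst x)"
        by (cases "?c (fst x)") auto
      then show "ennreal (?G2 x) \<le> ?c (fst x) * ennreal (f (snd x))"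
        by (simp add: ennreal_mult f0 mult_right_mono)
    qed
    also have "\<dots> = (\<integral>\<^sup>+s. \<integral>\<^sup>+z. ?c s * ennreal (f z) \<partial>(?L \<Otimes>\<^sub>M ?L) \<partial>?L)"
      by (subst sigma_finite_measure.nn_integral_fst[OF sf2, symmetric]) auto
    also have "\<dots> = 1"
      by (simp add: nn_integral_cmult nn_integral_distributed_eq_1[OF f] c_1)
    finally show ?thesis .
  qed
  have u2: "integrable M ?u2" "(\<integral>\<omega>. ?u2 \<omega> \<partial>M) \<le> 1"
  proof -
    have *: "?G2 \<in> borel_measurable (?L \<Otimes>\<^sub>M (?L \<Otimes>\<^sub>M ?L))" by measurable
    have **: "0 \<le> ?G2 x" for x by (simp add: f0)
    show "integrable M ?u2" "(\<integral>\<omega>. ?u2 \<omega> \<partial>M) \<le> 1"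
      by (rule expectation_density_ratio_le_1[OF k k0 * ** G2])+
  qed

  \<comment> \<open>The upper bound for the sum\<close>
  have c3: "cdent M lborel (lborel \<Otimes>\<^sub>M lborel) (\<lambda>\<omega>. X\<^sub>2 \<omega> + Y' \<omega>) (\<lambda>\<omega>. (X\<^sub>1 \<omega>, Ym \<omega>))
    = (\<integral>\<omega>. ln (f (X\<^sub>1 \<omega>, Ym \<omega>)) \<partial>M) - (\<integral>\<omega>. ln (k (X\<^sub>2 \<omega> + Y' \<omega>, (X\<^sub>1 \<omega>, Ym \<omega>))) \<partial>M)"
  proof -
    have "cdent M lborel (lborel \<Otimes>\<^sub>M lborel) (\<lambda>\<omega>. X\<^sub>2 \<omega> + Y' \<omega>) (\<lambda>\<omega>. (X\<^sub>1 \<omega>, Ym \<omega>))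
      = - (\<integral>\<omega>. ln (k (X\<^sub>2 \<omega> + Y' \<omega>, (X\<^sub>1 \<omega>, Ym \<omega>)) / f (X\<^sub>1 \<omega>, Ym \<omega>)) \<partial>M)"
      by (rule conditional_entropy_eq_expectation[OF sf sf2 k k0 f1 f0])
    also have "(\<integral>\<omega>. ln (k (X\<^sub>2 \<omega> + Y' \<omega>, (X\<^sub>1 \<omega>, Ym \<omega>)) / f (X\<^sub>1 \<omega>, Ym \<omega>)) \<partial>M)
      = (\<integral>\<omega>. ln (k (X\<^sub>2 \<omega> + Y' \<omega>, (X\<^sub>1 \<omega>, Ym \<omega>))) - ln (f (X\<^sub>1 \<omega>, Ym \<omega>)) \<partial>M)"
    proof (rule integral_cong_AE)
      show "AE \<omega> in M. ln (k (X\<^sub>2 \<omega> + Y' \<omega>, (X\<^sub>1 \<omega>, Ym \<omega>)) / f (X\<^sub>1 \<omega>, Ym \<omega>))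
          = ln (k (X\<^sub>2 \<omega> + Y' \<omega>, (X\<^sub>1 \<omega>, Ym \<omega>))) - ln (f (X\<^sub>1 \<omega>, Ym \<omega>))"
        using pos by eventually_elim (simp add: ln_div)
    qed measurable
    finally show ?thesis
      by (simp del: integral_distributed_eq[OF f1 f f0 ln_f])
  qed

  \<comment> \<open>The expanded sum of \<open>ln\<close> of \<open>?u1\<close> and
    \<open>ln\<close> of \<open>?u2\<close>, after \<open>ln\<close> of \<open>?r\<close> and of
    \<open>f (X\<^sub>1 \<omega>, Ym \<omega>)\<close> have cancelled. Every remaining term is known
    to be integrable, so its expectation splits.\<close>
  let ?t = "\<lambda>\<omega>. ln (g (X\<^sub>2 \<omega> + Ym \<omega>)) + ln (g (X\<^sub>1 \<omega> + Ym \<omega>)) + ln (g (X\<^sub>1 \<omega> + Y' \<omega>))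
    + ln (a (X\<^sub>2 \<omega>)) + ln (b (Y' \<omega>)) + ln (b (Ym \<omega>)) + ln (a (X\<^sub>1 \<omega>))
    - ln (f (X\<^sub>1 \<omega>, Y' \<omega>)) - ln (f (X\<^sub>2 \<omega>, Ym \<omega>)) - ln (k (X\<^sub>2 \<omega> + Y' \<omega>, (X\<^sub>1 \<omega>, Ym \<omega>)))"
  have "(\<integral>\<omega>. ?t \<omega> \<partial>M) \<le> (\<integral>\<omega>. ?u1 \<omega> + ?u2 \<omega> - 2 \<partial>M)"
  proof (rule integral_mono_AE)
    show "AE \<omega> in M. ?t \<omega> \<le> ?u1 \<omega> + ?u2 \<omega> - 2"
      using pos r_pos
    proof eventually_elim
      case (elim \<omega>)
      then have "0 < ?u1 \<omega>" "0 < ?u2 \<omega>" by simp_all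
      then have "ln (?u1 \<omega>) + ln (?u2 \<omega>) \<le> ?u1 \<omega> + ?u2 \<omega> - 2"
        using ln_le_minus_one[of "?u1 \<omega>"] ln_le_minus_one[of "?u2 \<omega>"] by linarith
      moreover have "ln (?u1 \<omega>) + ln (?u2 \<omega>) = ?t \<omega>"
        using elim by (simp add: ln_mult ln_div)
      ultimately show ?case by linarith
    qed
  qed (use u1(1) u2(1) in auto)
  also have "\<dots> = (\<integral>\<omega>. ?u1 \<omega> \<partial>M) + (\<integral>\<omega>. ?u2 \<omega> \<partial>M) - 2"
    using u1(1) u2(1) by (simp add: prob_space)
  also have "\<dots> \<le> 0"
    using u1(2) u2(2) by linarith
  finally have "(\<integral>\<omega>. ?t \<omega> \<partial>M) \<le> 0" .
  \<comment> \<open>Each expectation is minus an entropy. \<open>?t\<close> supplies two copies of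
    the entropy of \<open>(X, Y)\<close>; the third comes from the term of
    \<open>(X\<^sub>1, Ym)\<close> in \<open>c3\<close>.\<close>
  then have "cdent M lborel (lborel \<Otimes>\<^sub>M lborel) (\<lambda>\<omega>. X\<^sub>2 \<omega> + Y' \<omega>) (\<lambda>\<omega>. (X\<^sub>1 \<omega>, Ym \<omega>))
    \<le> 3 * dent M lborel (\<lambda>\<omega>. X \<omega> + Y \<omega>) + 2 * dent M lborel X + 2 * dent M lborel Y
      - 3 * dent M (lborel \<Otimes>\<^sub>M lborel) (\<lambda>\<omega>. (X \<omega>, Y \<omega>))"
    unfolding c3 h by simp
  \<comment> \<open>Three uses of \<open>hS\<close> and three of \<open>hI\<close> cost
    \<open>6 * ln K\<close>; nonnegativity of \<open>ln K\<close> weakens this to the stated factor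
    7.\<close>
  moreover have "0 \<le> ln K"
    using K by simp
  ultimately show ?thesis
    unfolding c1 c2 using hI hS by auto
qed

end
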